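(* Let $\Omega, T, A, B, g, \varphi, R$ satisfy the standing assumptions listed in the context. For $j=1,2$, let $F_j\in \mathcal{C}^1(\mathbb{R})$ satisfy $F_j(0)=0$ and $F_j'(s)\ge 0$ for all $s\in\mathbb{R}$, and let $u_j$ be the solution of $$ \left\{\begin{aligned} \partial_t u_j-\nabla\cdot(A\nabla u_j)+B\cdot\nabla u_j+F_j(u_j)&=0 &&\text{in }\Omega\times(0,T),\\ u_j(x,t)&=\varphi(t)g(x) &&\text{on }\partial\Omega\times(0,T),\\ u_j(\cdot,0)&=0 &&\text{in }\Omega. \end{aligned}\right. $$ Let $S$ be an arbitrary open and non-empty subset of $\partial\Omega$, and suppose that $$\partial_{\nu_A}u_1(x,t)=\partial_{\nu_A}u_2(x,t),\qquad (x,t)\in S\times(0,T).$$ Then one of the following two conditions holds: (i) the function $F=F_2-F_1$ changes sign an infinite number of times on $[0,R]$; (ii) $F_1\equiv F_2$ on $[0,R]$.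
   Context: Standing assumptions. $d\ge 1$, $\alpha\in(0,1)$, $0<T<\infty$; $\Omega\subset\mathbb{R}^d$ is an open bounded domain with $\mathcal{C}^{2+\alpha}$ boundary $\partial\Omega$ and unit outward normal $\nu$. $B\in\mathcal{C}^{1+\alpha}(\overline\Omega\times[0,T];\mathbb{R}^d)$. $A=(a_{ij})_{1\le i,j\le d}$ with $a_{ij}\in\mathcal{C}^{1+\alpha}(\overline\Omega\times[0,T])$, $a_{ij}=a_{ji}$, and there is a constant $c>0$ with $\xi^TA(x,t)\xi\ge c|\xi|^2$ for all $(x,t)\in\overline\Omega\times[0,T]$, $\xi\in\mathbb{R}^d$. Boundary data. $\kappa,R>0$ are fixed constants. $g\in\mathcal{C}^{2+\alpha}(\partial\Omega)$ with $\|g\|_{\mathcal{C}^{2+\alpha}(\partial\Omega)}\le\kappa$ and $g(\partial\Omega)=[0,R]$. $\varphi\in\mathcal{C}^\infty([0,T])$ with $\|\varphi\|_{\mathcal{C}^{1+\alpha/2}([0,T])}\le\kappa$ and $\varphi(t)=0$ for $0\le t\le T_1$, $\varphi(t)=f(t)$ for $T_1\le t\le T_2$, $\varphi(t)=1$ for $T_2\le t\le T$, where $0\le T_1<T_2\le T$, $T_2-T_1\ge T/4$, and $f\in\mathcal{C}^\infty([T_1,T_2])$ satisfies $f'(t)>0$ for $t\in(T_1,T_2)$. Under these assumptions the semilinear problem has a unique solution in the parabolic Hölder space $\mathcal{C}^{2+\alpha,1+\alpha/2}(\overline\Omega\times[0,T])$; "the solution" means this one. The conormal derivative is $\partial_{\nu_A}u(x,t)=A(x,t)\nabla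 u(x,t)\cdot\nu(x)$ for $(x,t)\in\partial\Omega\times[0,T]$. Sign changes. $F$ changes sign at most $N$ times on $[0,R]$ if there are points $0=s_0\le s_1\le\dots\le s_N\le s_{N+1}=R$ such that on each interval $[s_j,s_{j+1}]$, $0\le j\le N$, either $F\ge0$ throughout or $F\le 0$ throughout. $F$ changes sign an infinite number of times on $[0,R]$ if this holds for no $N\in\{0,1,2,\dots\}$. *)

theory Defs
  imports "HOL-Analysis.Analysis"
begin

section \<open>Differentiability and Hoelder spaces up to the boundary\<close>

text \<open>
  All derivatives are taken relative to a set \<open>S\<close>, so that they make sense at boundary points of
  closed domains. At interior points of \<open>S\<close> they are the ordinary derivatives. The sets used below
  (open sets, nondegenerate compact intervals, closures of domains with \<open>C\<close>-two-alpha boundary, and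
  products of such a closure with an interval) have a tangent cone with nonempty interior at each
  of their points, so the relative derivative is unique there. For these sets, being \<open>k\<close> times
  continuously differentiable relative to \<open>S\<close> is the same as having derivatives of order at most
  \<open>k\<close> in the interior which extend continuously to \<open>S\<close>, and the relative derivatives on the
  boundary are these extensions.
\<close>

definition partial_in ::
  "'a::euclidean_space set \<Rightarrow> 'a \<Rightarrow> ('a \<Rightarrow> 'b::real_normed_vector) \<Rightarrow> 'a \<Rightarrow> 'b" where
  "partial_in S v f x = frechet_derivative f (at x within S) v"

fun C_diff_on :: "nat \<Rightarrow> 'a::euclidean_space set \<Rightarrow> ('a \<Rightarrow> 'b::real_normed_vector) \<Rightarrow> bool" where
  "C_diff_on 0 S f \<longleftrightarrow> continuous_on S f"
| "C_diff_on (Suc k) S f \<longleftrightarrow>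
     f differentiable_on S \<and> (\<forall>i\<in>Basis. C_diff_on k S (partial_in S i f))"

definition C_infinity_on :: "'a::euclidean_space set \<Rightarrow> ('a \<Rightarrow> 'b::real_normed_vector) \<Rightarrow> bool" where
  "C_infinity_on S f \<longleftrightarrow> (\<forall>k. C_diff_on k S f)"

definition sup_norm_on :: "'a set \<Rightarrow> ('a \<Rightarrow> 'b::real_normed_vector) \<Rightarrow> ennreal" where
  "sup_norm_on S f = (SUP x\<in>S. ennreal (norm (f x)))"

definition holder_seminorm ::
  "real \<Rightarrow> 'a::metric_space set \<Rightarrow> ('a \<Rightarrow> 'b::real_normed_vector) \<Rightarrow> ennreal" where
  "holder_seminorm \<beta> S f =
     (SUP x\<in>S. SUP y\<in>S - {x}. ennreal (norm (f x - f y) / dist x y powr \<beta>))"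

text \<open>
  \<open>holder_norm k \<beta> S f\<close> is the sum of the sup norms of all iterated partial derivatives of order at
  most \<open>k\<close> and of the \<open>\<beta>\<close>-Hoelder seminorms of those of order \<open>k\<close>, where mixed derivatives are
  counted once for each order of differentiation. Its value is infinite if one of them is
  unbounded.
\<close>

fun holder_norm ::
  "nat \<Rightarrow> real \<Rightarrow> 'a::euclidean_space set \<Rightarrow> ('a \<Rightarrow> 'b::real_normed_vector) \<Rightarrow> ennreal" where
  "holder_norm 0 \<beta> S f = sup_norm_on S f + holder_seminorm \<beta> S f"
| "holder_norm (Suc k) \<beta> S f =
     sup_norm_on S f + (\<Sum>i\<in>Basis. holder_norm k \<beta> S (partial_in S i f))"

definition holder_on ::
  "nat \<Rightarrow> real \<Rightarrow> 'a::euclidean_space set \<Rightarrow> ('a \<Rightarrow> 'b::real_normed_vector) \<Rightarrow> bool" where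
  "holder_on k \<beta> S f \<longleftrightarrow> C_diff_on k S f \<and> holder_norm k \<beta> S f < \<infinity>"


section \<open>Domains with Hoelder boundary\<close>

text \<open>
  Near each boundary point, a diffeomorphism of the given class straightens the boundary and maps
  the domain to one side of a coordinate hyperplane.
\<close>

definition holder_boundary :: "nat \<Rightarrow> real \<Rightarrow> (real^'n) set \<Rightarrow> bool" where
  "holder_boundary k \<beta> \<Omega> \<longleftrightarrow>
     (\<forall>x\<in>frontier \<Omega>. \<exists>U V (\<psi> :: real^'n \<Rightarrow> real^'n) \<psi>' m.
        open U \<and> x \<in> U \<and> open V \<and> homeomorphism U V \<psi> \<psi>' \<and>
        holder_on k \<beta> U \<psi> \<and> holder_on k \<beta> V \<psi>' \<and>
        \<psi> ` (U \<inter> \<Omega>) = V \<inter> {y. y $ m > 0} \<and>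
        \<psi> ` (U \<inter> frontier \<Omega>) = V \<inter> {y. y $ m = 0})"

definition is_bounded_holder_domain :: "nat \<Rightarrow> real \<Rightarrow> (real^'n) set \<Rightarrow> bool" where
  "is_bounded_holder_domain k \<beta> \<Omega> \<longleftrightarrow>
     open \<Omega> \<and> connected \<Omega> \<and> \<Omega> \<noteq> {} \<and> bounded \<Omega> \<and> holder_boundary k \<beta> \<Omega>"

text \<open>
  Boundary functions (Gilbarg and Trudinger, Section 6.2): the Hoelder space on the boundary
  consists of the restrictions of the Hoelder functions on the closed domain, and the norm is the
  infimum of the norms of the extensions.
\<close>

definition holder_extensions ::
  "nat \<Rightarrow> real \<Rightarrow> (real^'n) set \<Rightarrow> (real^'n \<Rightarrow> real) \<Rightarrow> (real^'n \<Rightarrow> real) set" where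
  "holder_extensions k \<beta> \<Omega> g =
     {G. holder_on k \<beta> (closure \<Omega>) G \<and> (\<forall>x\<in>frontier \<Omega>. G x = g x)}"

definition boundary_holder :: "nat \<Rightarrow> real \<Rightarrow> (real^'n) set \<Rightarrow> (real^'n \<Rightarrow> real) \<Rightarrow> bool" where
  "boundary_holder k \<beta> \<Omega> g \<longleftrightarrow> holder_extensions k \<beta> \<Omega> g \<noteq> {}"

definition boundary_holder_norm ::
  "nat \<Rightarrow> real \<Rightarrow> (real^'n) set \<Rightarrow> (real^'n \<Rightarrow> real) \<Rightarrow> ennreal" where
  "boundary_holder_norm k \<beta> \<Omega> g = (INF G\<in>holder_extensions k \<beta> \<Omega> g. holder_norm k \<beta> (closure \<Omega>) G)"

definition boundary_tangent :: "(real^'n) set \<Rightarrow> real^'n \<Rightarrow> real^'n \<Rightarrow> bool" where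
  "boundary_tangent \<Omega> x v \<longleftrightarrow>
     (\<exists>\<gamma>. \<gamma> 0 = x \<and> (\<forall>\<^sub>F s in nhds 0. \<gamma> s \<in> frontier \<Omega>) \<and>
          (\<gamma> has_vector_derivative v) (at (0::real)))"

definition is_unit_outward_normal :: "(real^'n) set \<Rightarrow> real^'n \<Rightarrow> real^'n \<Rightarrow> bool" where
  "is_unit_outward_normal \<Omega> x n \<longleftrightarrow>
     norm n = 1 \<and> (\<forall>v. boundary_tangent \<Omega> x v \<longrightarrow> n \<bullet> v = 0) \<and>
     (\<forall>\<^sub>F s in at_right (0::real). x - s *\<^sub>R n \<in> \<Omega> \<and> x + s *\<^sub>R n \<notin> closure \<Omega>)"


section \<open>Parabolic Hoelder space\<close>

text \<open>
  The space with two plus alpha spatial and one plus half alpha temporal derivatives, on the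
  closure of \<open>\<Omega>\<close> times \<open>[0,T]\<close>. The norm is that of Ladyzhenskaya, Solonnikov and Ural'ceva: sup
  norms of \<open>u\<close>, its gradient, its Hessian and its time derivative; Hoelder seminorms in \<open>x\<close> of
  exponent \<open>\<alpha>\<close> of the Hessian and the time derivative; Hoelder seminorms in \<open>t\<close> of exponent
  \<open>\<alpha>/2\<close> of the Hessian and the time derivative, and of exponent \<open>(1+\<alpha>)/2\<close> of the gradient. If it is
  finite, then all these derivatives are jointly continuous in \<open>(x,t)\<close>.
\<close>

definition time_deriv :: "real \<Rightarrow> ('a \<Rightarrow> real \<Rightarrow> real) \<Rightarrow> 'a \<Rightarrow> real \<Rightarrow> real" where
  "time_deriv T u x t = vector_derivative (\<lambda>s. u x s) (at t within {0..T})"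

definition space_partial ::
  "(real^'n) set \<Rightarrow> 'n \<Rightarrow> (real^'n \<Rightarrow> real \<Rightarrow> real) \<Rightarrow> real^'n \<Rightarrow> real \<Rightarrow> real" where
  "space_partial \<Omega> i u x t = partial_in (closure \<Omega>) (axis i 1) (\<lambda>y. u y t) x"

definition cyl_sup :: "(real^'n) set \<Rightarrow> real \<Rightarrow> (real^'n \<Rightarrow> real \<Rightarrow> real) \<Rightarrow> ennreal" where
  "cyl_sup \<Omega> T v = (SUP t\<in>{0..T}. sup_norm_on (closure \<Omega>) (\<lambda>x. v x t))"

definition cyl_holder_x :: "real \<Rightarrow> (real^'n) set \<Rightarrow> real \<Rightarrow> (real^'n \<Rightarrow> real \<Rightarrow> real) \<Rightarrow> ennreal" where
  "cyl_holder_x \<beta> \<Omega> T v = (SUP t\<in>{0..T}. holder_seminorm \<beta> (closure \<Omega>) (\<lambda>x. v x t))"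

definition cyl_holder_t :: "real \<Rightarrow> (real^'n) set \<Rightarrow> real \<Rightarrow> (real^'n \<Rightarrow> real \<Rightarrow> real) \<Rightarrow> ennreal" where
  "cyl_holder_t \<beta> \<Omega> T v = (SUP x\<in>closure \<Omega>. holder_seminorm \<beta> {0..T} (\<lambda>t. v x t))"

definition parabolic_holder_norm ::
  "real \<Rightarrow> (real^'n) set \<Rightarrow> real \<Rightarrow> (real^'n \<Rightarrow> real \<Rightarrow> real) \<Rightarrow> ennreal" where
  "parabolic_holder_norm \<alpha> \<Omega> T u =
     (let N = (\<lambda>v. cyl_sup \<Omega> T v + cyl_holder_x \<alpha> \<Omega> T v + cyl_holder_t (\<alpha> / 2) \<Omega> T v)
      in cyl_sup \<Omega> T u
         + (\<Sum>i\<in>UNIV. cyl_sup \<Omega> T (space_partial \<Omega> i u)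
                      + cyl_holder_t ((1 + \<alpha>) / 2) \<Omega> T (space_partial \<Omega> i u))
         + (\<Sum>i\<in>UNIV. \<Sum>j\<in>UNIV. N (space_partial \<Omega> j (space_partial \<Omega> i u)))
         + N (time_deriv T u))"

definition parabolic_holder ::
  "real \<Rightarrow> (real^'n) set \<Rightarrow> real \<Rightarrow> (real^'n \<Rightarrow> real \<Rightarrow> real) \<Rightarrow> bool" where
  "parabolic_holder \<alpha> \<Omega> T u \<longleftrightarrow>
     (\<forall>t\<in>{0..T}. C_diff_on 2 (closure \<Omega>) (\<lambda>x. u x t)) \<and>
     (\<forall>x\<in>closure \<Omega>. C_diff_on 1 {0..T} (\<lambda>t. u x t)) \<and>
     parabolic_holder_norm \<alpha> \<Omega> T u < \<infinity>"


section \<open>The semilinear problem\<close>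

definition space_grad ::
  "(real^'n) set \<Rightarrow> (real^'n \<Rightarrow> real \<Rightarrow> real) \<Rightarrow> real^'n \<Rightarrow> real \<Rightarrow> real^'n" where
  "space_grad \<Omega> u x t = (\<chi> i. space_partial \<Omega> i u x t)"

definition space_div ::
  "(real^'n) set \<Rightarrow> (real^'n \<Rightarrow> real \<Rightarrow> real^'n) \<Rightarrow> real^'n \<Rightarrow> real \<Rightarrow> real" where
  "space_div \<Omega> W x t = (\<Sum>i\<in>UNIV. space_partial \<Omega> i (\<lambda>y s. W y s $ i) x t)"

definition is_semilinear_solution ::
  "real \<Rightarrow> (real^'n) set \<Rightarrow> real \<Rightarrow> (real^'n \<Rightarrow> real \<Rightarrow> real^'n^'n) \<Rightarrow> (real^'n \<Rightarrow> real \<Rightarrow> real^'n) \<Rightarrow>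
   (real \<Rightarrow> real) \<Rightarrow> (real \<Rightarrow> real) \<Rightarrow> (real^'n \<Rightarrow> real) \<Rightarrow> (real^'n \<Rightarrow> real \<Rightarrow> real) \<Rightarrow> bool" where
  "is_semilinear_solution \<alpha> \<Omega> T A B F \<phi> g u \<longleftrightarrow>
     parabolic_holder \<alpha> \<Omega> T u \<and>
     (\<forall>x\<in>\<Omega>. \<forall>t\<in>{0<..<T}.
        time_deriv T u x t - space_div \<Omega> (\<lambda>y s. A y s *v space_grad \<Omega> u y s) x t
          + B x t \<bullet> space_grad \<Omega> u x t + F (u x t) = 0) \<and>
     (\<forall>x\<in>frontier \<Omega>. \<forall>t\<in>{0<..<T}. u x t = \<phi> t * g x) \<and>
     (\<forall>x\<in>\<Omega>. u x 0 = 0)"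

definition conormal_deriv ::
  "(real^'n) set \<Rightarrow> (real^'n \<Rightarrow> real^'n) \<Rightarrow> (real^'n \<Rightarrow> real \<Rightarrow> real^'n^'n) \<Rightarrow>
   (real^'n \<Rightarrow> real \<Rightarrow> real) \<Rightarrow> real^'n \<Rightarrow> real \<Rightarrow> real" where
  "conormal_deriv \<Omega> \<nu> A u x t = (A x t *v space_grad \<Omega> u x t) \<bullet> \<nu> x"


section \<open>Sign changes\<close>

definition changes_sign_at_most :: "nat \<Rightarrow> (real \<Rightarrow> real) \<Rightarrow> real \<Rightarrow> bool" where
  "changes_sign_at_most N F R \<longleftrightarrow>
     (\<exists>s::nat \<Rightarrow> real. s 0 = 0 \<and> s (Suc N) = R \<and> (\<forall>j\<le>N. s j \<le> s (Suc j)) \<and>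
        (\<forall>j\<le>N. (\<forall>r\<in>{s j..s (Suc j)}. F r \<ge> 0) \<or> (\<forall>r\<in>{s j..s (Suc j)}. F r \<le> 0)))"

definition changes_sign_infinitely :: "(real \<Rightarrow> real) \<Rightarrow> real \<Rightarrow> bool" where
  "changes_sign_infinitely F R \<longleftrightarrow> (\<forall>N. \<not> changes_sign_at_most N F R)"

end

theory Submission
  imports Defs
begin

text \<open>
  Suppose \<open>F\<^sub>1 \<le> F\<^sub>2\<close> on \<open>[0,\<sigma>]\<close>. As long as \<open>\<phi> R \<le> \<sigma>\<close>, the maximum principle confines
  both solutions to \<open>[0,\<sigma>]\<close>, so \<open>w = u\<^sub>1 - u\<^sub>2\<close> is a nonnegative supersolution of a linear
  parabolic equation which vanishes on the boundary. If \<open>w\<close> were positive at some point, it would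
  be positive in the whole domain at all later times (strong maximum principle), and Hopf's lemma
  would give it a nonzero conormal derivative on \<open>S\<close>. Hence \<open>u\<^sub>1 = u\<^sub>2\<close> and
  \<open>F\<^sub>1 (u\<^sub>2) = F\<^sub>2 (u\<^sub>2)\<close>, and since the boundary values already cover \<open>[0,\<sigma>]\<close>, \<open>F\<^sub>1 = F\<^sub>2\<close>
  there. The set where the nonlinearities agree thus extends from each interval of constant sign of
  \<open>F\<^sub>2 - F\<^sub>1\<close> to the next one. The strong maximum principle and Hopf's lemma both follow from one
  barrier, supported in a ball with moving centre and growing radius.
\<close>

section \<open>A minimum principle\<close>

text \<open>The sign of F2 - F1 on one interval alone is of no use: both solutions start from 0 and
  pass through every lower level, so the comparison needs the sign on all of [0,\<sigma>]. Hence the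
  intervals are treated from the left, with equality already known below; with infinitely many sign
  changes there may be no next interval to go on with. The linear inequality comes from the
  splitting F2(u2) - F1(u1) = (F2 - F1)(u2) - (F1(u1) - F1(u2)). The first part is nonnegative, and
  a Lipschitz constant Q of F1 on [0,R] bounds the second, so the right-hand side is at least -Q w.
  At the boundary two difficulties meet. Hopf's lemma acts where a ball touches the boundary from
  inside, whereas the normal is known only through its orthogonality to boundary curves and the side
  it points to; a touching point is therefore sought within S, and the normal there is identified
  with the radius of the ball. Moreover the measured derivative is in the oblique direction A \<nu>;
  ellipticity makes this direction cross the sphere.\<close>

definition psd :: "real^'n^'n \<Rightarrow> bool" where
  "psd a \<longleftrightarrow> (\<forall>i j. a $ i $ j = a $ j $ i) \<and> (\<forall>\<xi>. 0 \<le> \<xi> \<bullet> (a *v \<xi>))"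

definition outer :: "real^'n \<Rightarrow> real^'n^'n" where
  "outer d = (\<chi> i j. d $ i * d $ j)"

lemma inner_outer: "(H :: real^'n^'n) \<bullet> outer d = d \<bullet> (H *v d)"
  by (simp add: inner_vec_def outer_def matrix_vector_mult_def sum_distrib_left mult_ac)

lemma outer_mult_vec: "outer d *v \<xi> = (d \<bullet> \<xi>) *\<^sub>R d"
  by (simp add: vec_eq_iff outer_def matrix_vector_mult_def inner_vec_def sum_distrib_left sum_distrib_right mult_ac)

text \<open>The form at a point shifted by \<open>s\<close> along a coordinate vector is a quadratic
  polynomial in \<open>s\<close>. A zero diagonal entry makes it affine; otherwise its minimum gives
  the Schur complement.\<close>

lemma psd_quadratic_shift:
  assumes "psd a"
  shows "0 \<le> \<xi> \<bullet> (a *v \<xi>) + 2 * s * (a $ i \<bullet> \<xi>) + s\<^sup>2 * a $ i $ i"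
proof -
  have sym: "a $ j $ k = a $ k $ j" for j k
    using assms by (auto simp: psd_def)
  have 1: "a *v axis i 1 = a $ i"
    by (simp add: vec_eq_iff matrix_vector_mult_basis column_def sym[of _ i])
  have 2: "(a *v \<xi>) $ i = a $ i \<bullet> \<xi>"
    by (simp add: matrix_vector_mult_def inner_vec_def)
  have "0 \<le> (\<xi> + s *\<^sub>R axis i 1) \<bullet> (a *v (\<xi> + s *\<^sub>R axis i 1))"
    using assms by (auto simp: psd_def)
  also have "\<dots> = \<xi> \<bullet> (a *v \<xi>) + 2 * s * (a $ i \<bullet> \<xi>) + s\<^sup>2 * a $ i $ i"
    by (simp add: matrix_vector_right_distrib matrix_vector_mult_scaleR inner_add_left inner_add_right
        1 inner_axis' power2_eq_square algebra_simps inner_commute[of \<xi>] 2)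
  finally show ?thesis .
qed

lemma psd_zero_diagonal:
  assumes "psd a" "a $ i $ i = 0"
  shows "a $ i = 0"
proof (rule ccontr)
  assume "a $ i \<noteq> 0"
  then have pos: "a $ i \<bullet> a $ i > 0" by simp
  define q where "q = (a $ i) \<bullet> (a *v (a $ i))"
  have "0 \<le> q + 2 * s * (a $ i \<bullet> a $ i)" for s
    using psd_quadratic_shift[OF assms(1), of "a $ i" s i] assms(2) by (simp add: q_def)
  \<comment> \<open>At this \<open>s\<close> the affine function takes the value -1.\<close>
  from this[of "- (q + 1) / (2 * (a $ i \<bullet> a $ i))"] pos show False
    by (simp add: field_simps)
qed

text \<open>A step of the Cholesky algorithm splits off a rank one matrix and clears one more row.\<close>

lemma psd_inner_nonneg:
  fixes a H :: "real^'n^'n"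
  assumes "psd a" and H: "\<And>\<xi>. 0 \<le> \<xi> \<bullet> (H *v \<xi>)"
  shows "0 \<le> a \<bullet> H"
  using assms(1)
proof (induction "card {i. a $ i \<noteq> 0}" arbitrary: a rule: less_induct)
  case less
  have sym: "a $ j $ k = a $ k $ j" for j k
    using less.prems by (auto simp: psd_def)
  show ?case
  proof (cases "a = 0")
    case False
    then obtain i where i: "a $ i \<noteq> 0" by (auto simp: vec_eq_iff)
    have ne: "a $ i $ i \<noteq> 0" using psd_zero_diagonal[OF less.prems] i by blast
    have "0 \<le> axis i 1 \<bullet> (a *v axis i 1)" using less.prems by (auto simp: psd_def)
    then have ai: "a $ i $ i > 0"
      using ne by (simp add: inner_axis' matrix_vector_mult_basis column_def)
    define a' where "a' = a - (1 / a $ i $ i) *\<^sub>R outer (a $ i)"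
    have psd': "psd a'"
      unfolding psd_def
    proof (intro conjI allI)
      fix j k show "a' $ j $ k = a' $ k $ j" by (simp add: a'_def outer_def sym[of j k])
    next
      fix \<xi> :: "real^'n"
      have "\<xi> \<bullet> (a' *v \<xi>) = \<xi> \<bullet> (a *v \<xi>) - (a $ i \<bullet> \<xi>)\<^sup>2 / a $ i $ i"
        by (simp add: a'_def matrix_vector_mult_diff_rdistrib inner_diff_right
            scaleR_matrix_vector_assoc[symmetric] outer_mult_vec power2_eq_square inner_commute)
      \<comment> \<open>The minimising shift: the form of \<open>a'\<close> at \<open>\<xi>\<close>
        is the form of \<open>a\<close> at the shifted point.\<close>
      also have "\<dots> = \<xi> \<bullet> (a *v \<xi>) + 2 * (- (a $ i \<bullet> \<xi>) / a $ i $ i) * (a $ i \<bullet> \<xi>)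
          + (- (a $ i \<bullet> \<xi>) / a $ i $ i)\<^sup>2 * a $ i $ i"
        using ai by (simp add: field_simps power2_eq_square)
      finally show "0 \<le> \<xi> \<bullet> (a' *v \<xi>)"
        using psd_quadratic_shift[OF less.prems] by metis
    qed
    \<comment> \<open>By symmetry a zero row \<open>k\<close> has \<open>a $ i $ k = 0\<close> and
      survives the subtraction unchanged, so the number of nonzero rows drops.\<close>
    have "{k. a' $ k \<noteq> 0} \<subseteq> {k. a $ k \<noteq> 0} - {i}"
    proof -
      have "a' $ i = 0" using ai by (simp add: vec_eq_iff a'_def outer_def)
      moreover have "a' $ k = 0" if "a $ k = 0" for k
        using that sym[of i k] by (simp add: vec_eq_iff a'_def outer_def)
      ultimately show ?thesis by auto
    qed
    then have "card {k. a' $ k \<noteq> 0} \<le> card ({k. a $ k \<noteq> 0} - {i})"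
      by (intro card_mono) auto
    also have "\<dots> < card {k. a $ k \<noteq> 0}"
      using i by (intro card_Diff1_less) auto
    finally have "0 \<le> a' \<bullet> H" using less.hyps psd' by blast
    moreover have "a \<bullet> H = a' \<bullet> H + (1 / a $ i $ i) * (a $ i \<bullet> (H *v (a $ i)))"
      by (simp add: a'_def inner_diff_right inner_outer inner_commute[of _ H])
    ultimately show ?thesis using ai H[of "a $ i"] by simp
  qed simp
qed

text \<open>Derivatives at a single point are all that an argument at a minimum uses.
  \<open>H\<close> is the derivative of the gradient map, so its rows are the gradients of the first
  partial derivatives. The time derivative is two-sided, so top times stay strictly below
  \<open>T\<close>.\<close>

definition parabolic_jet ::
  "(real^'n \<Rightarrow> real \<Rightarrow> real) \<Rightarrow> real^'n \<Rightarrow> real \<Rightarrow> real \<Rightarrow> real^'n \<Rightarrow> real^'n^'n \<Rightarrow> bool" where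
  "parabolic_jet v x t \<tau> p H \<longleftrightarrow> ((\<lambda>s. v x s) has_real_derivative \<tau>) (at t) \<and>
     (\<exists>P. P x = p \<and> (\<forall>\<^sub>F y in nhds x. ((\<lambda>y. v y t) has_derivative (\<lambda>h. P y \<bullet> h)) (at y)) \<and>
          (P has_derivative (\<lambda>h. H *v h)) (at x))"

lemma parabolic_jet_const: "parabolic_jet (\<lambda>x t. k) x t 0 0 0"
  unfolding parabolic_jet_def
  by (intro conjI exI[of _ "\<lambda>_. 0"]) (auto simp: inner_zero_left[abs_def] matrix_vector_mult_0[abs_def])

lemma parabolic_jet_diff:
  assumes "parabolic_jet u x t \<tau> p H" "parabolic_jet v x t \<tau>' p' H'"
  shows "parabolic_jet (\<lambda>x t. u x t - v x t) x t (\<tau> - \<tau>') (p - p') (H - H')"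
proof -
  from assms(1) obtain P where P: "P x = p" "(P has_derivative (\<lambda>h. H *v h)) (at x)"
      "\<forall>\<^sub>F y in nhds x. ((\<lambda>y. u y t) has_derivative (\<lambda>h. P y \<bullet> h)) (at y)"
    by (auto simp: parabolic_jet_def)
  from assms(2) obtain P' where P': "P' x = p'" "(P' has_derivative (\<lambda>h. H' *v h)) (at x)"
      "\<forall>\<^sub>F y in nhds x. ((\<lambda>y. v y t) has_derivative (\<lambda>h. P' y \<bullet> h)) (at y)"
    by (auto simp: parabolic_jet_def)
  show ?thesis unfolding parabolic_jet_def
  proof (intro conjI exI[of _ "\<lambda>y. P y - P' y"])
    show "((\<lambda>s. u x s - v x s) has_real_derivative \<tau> - \<tau>') (at t)"
      using assms by (intro DERIV_diff) (auto simp: parabolic_jet_def)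
    show "\<forall>\<^sub>F y in nhds x. ((\<lambda>y. u y t - v y t) has_derivative (\<lambda>h. (P y - P' y) \<bullet> h)) (at y)"
      using P(3) P'(3)
      by eventually_elim (auto intro!: derivative_eq_intros simp: inner_diff_left)
    show "((\<lambda>y. P y - P' y) has_derivative (\<lambda>h. (H - H') *v h)) (at x)"
      using has_derivative_diff[OF P(2) P'(2)] by (simp add: matrix_vector_mult_diff_rdistrib)
  qed (simp add: P P')
qed

lemma parabolic_jet_scale:
  assumes "parabolic_jet u x t \<tau> p H"
  shows "parabolic_jet (\<lambda>x t. k * u x t) x t (k * \<tau>) (k *\<^sub>R p) (k *\<^sub>R H)"
proof -
  from assms obtain P where P: "P x = p" "(P has_derivative (\<lambda>h. H *v h)) (at x)"
      "\<forall>\<^sub>F y in nhds x. ((\<lambda>y. u y t) has_derivative (\<lambda>h. P y \<bullet> h)) (at y)"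
    by (auto simp: parabolic_jet_def)
  show ?thesis unfolding parabolic_jet_def
  proof (intro conjI exI[of _ "\<lambda>y. k *\<^sub>R P y"])
    show "((\<lambda>s. k * u x s) has_real_derivative k * \<tau>) (at t)"
      using assms by (intro DERIV_cmult) (auto simp: parabolic_jet_def)
    show "\<forall>\<^sub>F y in nhds x. ((\<lambda>y. k * u y t) has_derivative (\<lambda>h. (k *\<^sub>R P y) \<bullet> h)) (at y)"
      using P(3) by eventually_elim (auto intro!: derivative_eq_intros)
    show "((\<lambda>y. k *\<^sub>R P y) has_derivative (\<lambda>h. (k *\<^sub>R H) *v h)) (at x)"
      using has_derivative_scaleR_right[OF P(2), of k] by (simp add: scaleR_matrix_vector_assoc)
  qed (simp add: P)
qed

text \<open>If \<open>l\<close> were negative, \<open>f'\<close> would be negative just to the right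
  of its zero, and by the mean value theorem \<open>f\<close> would fall below
  \<open>f 0\<close>.\<close>

lemma second_derivative_local_min:
  fixes f f' :: "real \<Rightarrow> real"
  assumes min: "\<forall>\<^sub>F s in nhds 0. f 0 \<le> f s"
    and der: "\<forall>\<^sub>F s in nhds 0. (f has_real_derivative f' s) (at s)"
    and der2: "(f' has_real_derivative l) (at 0)"
  shows "f' 0 = 0" and "0 \<le> l"
proof -
  obtain d where d: "d > 0" "\<And>s. \<bar>s\<bar> < d \<Longrightarrow> f 0 \<le> f s \<and> (f has_real_derivative f' s) (at s)"
    using eventually_conj[OF min der] by (auto simp: eventually_nhds_metric)
  show f'0: "f' 0 = 0"
    by (rule DERIV_local_min[of f "f' 0" 0 d]) (use d in auto)
  show "0 \<le> l"
  proof (rule ccontr)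
    assume "\<not> 0 \<le> l"
    then obtain e where e: "e > 0" "\<And>h. h > 0 \<Longrightarrow> h < e \<Longrightarrow> f' (0 + h) < f' 0"
      using DERIV_neg_dec_right[OF der2] by auto
    define s where "s = min d e / 2"
    have s: "0 < s" "s < d" "s < e" using d e by (auto simp: s_def)
    have "\<exists>z>0. z < s \<and> f s - f 0 = (s - 0) * f' z"
      by (rule MVT2) (use s d in auto)
    then obtain z where z: "0 < z" "z < s" "f s - f 0 = s * f' z" by auto
    have "f' z < 0" using e(2)[of z] z s f'0 by simp
    then have "f s < f 0" using z s mult_pos_neg[of s "f' z"] by linarith
    moreover have "f 0 \<le> f s" using d(2)[of s] s by auto
    ultimately show False by simp
  qed
qed

text \<open>Restriction to lines through \<open>x\<close> reduces this to one variable; the line in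
  direction \<open>p\<close> gives \<open>p = 0\<close>.\<close>

lemma parabolic_jet_local_min:
  assumes "parabolic_jet v x t \<tau> p H" and min: "\<forall>\<^sub>F y in nhds x. v x t \<le> v y t"
  shows "p = 0" and "0 \<le> \<xi> \<bullet> (H *v \<xi>)"
proof -
  from assms obtain P where P: "P x = p" "(P has_derivative (\<lambda>h. H *v h)) (at x)"
      "\<forall>\<^sub>F y in nhds x. ((\<lambda>y. v y t) has_derivative (\<lambda>h. P y \<bullet> h)) (at y)"
    by (auto simp: parabolic_jet_def)
  have *: "p \<bullet> \<xi> = 0 \<and> 0 \<le> \<xi> \<bullet> (H *v \<xi>)" for \<xi>
  proof -
    define f where "f = (\<lambda>s. v (x + s *\<^sub>R \<xi>) t)"
    define f' where "f' = (\<lambda>s. P (x + s *\<^sub>R \<xi>) \<bullet> \<xi>)"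
    have lim: "filterlim (\<lambda>s. x + s *\<^sub>R \<xi>) (nhds x) (nhds 0)"
      by (rule tendsto_eq_rhs[OF tendsto_add[OF tendsto_const tendsto_scaleR[OF filterlim_ident tendsto_const]]])
        simp
    have 1: "\<forall>\<^sub>F s in nhds 0. f 0 \<le> f s"
      using eventually_compose_filterlim[OF min lim] by (simp add: f_def)
    have 2: "\<forall>\<^sub>F s in nhds 0. (f has_real_derivative f' s) (at s)"
      using eventually_compose_filterlim[OF P(3) lim]
    proof eventually_elim
      case (elim s)
      have "((\<lambda>s. x + s *\<^sub>R \<xi>) has_derivative (\<lambda>h. h *\<^sub>R \<xi>)) (at s)"
        by (auto intro!: derivative_eq_intros)
      from has_derivative_compose[OF this elim] show ?case
        by (simp add: has_field_derivative_def f_def f'_def mult.commute[of _ "_ \<bullet> _"])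
    qed
    have "((\<lambda>s. x + s *\<^sub>R \<xi>) has_derivative (\<lambda>h. h *\<^sub>R \<xi>)) (at 0)"
      by (auto intro!: derivative_eq_intros)
    moreover have "(P has_derivative (\<lambda>h. H *v h)) (at (x + 0 *\<^sub>R \<xi>))" using P(2) by simp
    ultimately have "((\<lambda>s. P (x + s *\<^sub>R \<xi>)) has_derivative (\<lambda>h. H *v (h *\<^sub>R \<xi>))) (at 0)"
      by (rule has_derivative_compose)
    then have "(f' has_derivative (\<lambda>h. (H *v (h *\<^sub>R \<xi>)) \<bullet> \<xi>)) (at 0)"
      unfolding f'_def by (rule has_derivative_inner_left)
    moreover have "(\<lambda>h. (H *v (h *\<^sub>R \<xi>)) \<bullet> \<xi>) = (*) (\<xi> \<bullet> (H *v \<xi>))"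
      by (simp add: fun_eq_iff matrix_vector_mult_scaleR inner_commute)
    ultimately have 3: "(f' has_real_derivative \<xi> \<bullet> (H *v \<xi>)) (at 0)"
      by (simp add: has_field_derivative_def)
    from second_derivative_local_min[OF 1 2 3] show ?thesis
      by (simp add: f'_def P)
  qed
  show "0 \<le> \<xi> \<bullet> (H *v \<xi>)" using * by blast
  have "p \<bullet> p = 0" using * by blast
  then show "p = 0" by simp
qed

text \<open>A comparison with earlier times only still gives a sign, so the minimum may sit at the
  top of the region.\<close>

lemma DERIV_left_min:
  fixes f :: "real \<Rightarrow> real"
  assumes "(f has_real_derivative l) (at t)" "\<forall>\<^sub>F s in at_left t. f t \<le> f s"
  shows "l \<le> 0"
proof (rule ccontr)
  assume "\<not> l \<le> 0"
  then obtain e where e: "e > 0" "\<And>h. h > 0 \<Longrightarrow> h < e \<Longrightarrow> f (t - h) < f t"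
    using DERIV_pos_inc_left[OF assms(1)] by auto
  have "\<forall>\<^sub>F s in at_left t. t - e < s \<and> s < t"
    using e by (intro eventually_conj eventually_at_leftI[of "t - e"]) auto
  with assms(2) have "\<forall>\<^sub>F s in at_left t. False"
  proof eventually_elim
    case (elim s)
    with e(2)[of "t - s"] show ?case by auto
  qed
  then show False by (simp add: eventually_False)
qed

text \<open>Used to turn equality of the solutions on an open cylinder into an identity between the
  nonlinearities. Both \<open>w\<close> and \<open>- w\<close> have a minimum at the point, which
  bounds \<open>a \<bullet> H\<close> by 0 from either side.\<close>

lemma parabolic_jet_zero:
  assumes J: "parabolic_jet w x t \<tau> p H" and "psd a" and U: "open U" "x \<in> U" "t \<in> {t1<..<t2}"
    and zero: "\<And>y s. y \<in> U \<Longrightarrow> s \<in> {t1<..<t2} \<Longrightarrow> w y s = (0::real)"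
  shows "\<tau> - a \<bullet> H + b \<bullet> p = 0"
proof -
  have U': "\<forall>\<^sub>F y in nhds x. y \<in> U" using U by (intro eventually_nhds_in_open)
  have J': "parabolic_jet (\<lambda>y s. 0 - w y s) x t (0 - \<tau>) (0 - p) (0 - H)"
    by (intro parabolic_jet_diff parabolic_jet_const J)
  have "\<forall>\<^sub>F y in nhds x. w x t \<le> w y t"
    using U' by eventually_elim (use zero U in auto)
  note m = parabolic_jet_local_min[OF J this]
  have "\<forall>\<^sub>F y in nhds x. 0 - w x t \<le> 0 - w y t"
    using U' by eventually_elim (use zero U in auto)
  note m' = parabolic_jet_local_min[OF J' this]
  have "(w x has_real_derivative \<tau>) (at t)" using J by (simp add: parabolic_jet_def)
  moreover have "(w x has_real_derivative 0) (at t)"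
    by (rule has_field_derivative_transform_within_open[of "\<lambda>_. 0" _ _ "{t1<..<t2}"])
       (use U zero in auto)
  ultimately have "\<tau> = 0" by (rule DERIV_unique)
  moreover have "0 \<le> a \<bullet> H" using psd_inner_nonneg[OF \<open>psd a\<close> m(2)] .
  moreover have "0 \<le> a \<bullet> (0 - H)" using psd_inner_nonneg[OF \<open>psd a\<close> m'(2)] .
  ultimately show ?thesis using m(1) by simp
qed

text \<open>Adding a small multiple of time makes the differential inequality strict.\<close>

lemma parabolic_minimum_principle:
  fixes v :: "real^'n \<Rightarrow> real \<Rightarrow> real"
  assumes Z: "compact Z" and cont: "continuous_on Z (\<lambda>z. v (fst z) (snd z))"
    and nbhd: "\<And>x t. (x, t) \<in> Z \<Longrightarrow> v x t < 0 \<Longrightarrow>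
       (\<forall>\<^sub>F y in nhds x. (y, t) \<in> Z) \<and> (\<forall>\<^sub>F s in at_left t. (x, s) \<in> Z)"
    and super: "\<And>x t. (x, t) \<in> Z \<Longrightarrow> v x t < 0 \<Longrightarrow>
       \<exists>\<tau> p H a b. parabolic_jet v x t \<tau> p H \<and> psd a \<and> 0 \<le> \<tau> - a \<bullet> H + b \<bullet> p"
    and z: "(x, t) \<in> Z"
  shows "0 \<le> v x t"
proof (rule ccontr)
  assume neg: "\<not> 0 \<le> v x t"
  have "bounded (snd ` Z)" using Z by (intro bounded_snd compact_imp_bounded)
  then obtain m where m: "\<And>x t. (x, t) \<in> Z \<Longrightarrow> \<bar>t\<bar> \<le> m"
    by (force simp: bounded_iff)
  \<comment> \<open>Shifting time by \<open>m\<close> makes the added term nonnegative on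
    \<open>Z\<close>, so a negative minimum of \<open>V\<close> is a negative point of
    \<open>v\<close>. The 2 in the denominator keeps \<open>V\<close> negative at the given
    point.\<close>
  define \<theta> where "\<theta> = - v x t / (2 * (m + \<bar>t\<bar> + 1))"
  have m0: "m \<ge> 0" using m[OF z] by linarith
  have \<theta>: "\<theta> > 0" unfolding \<theta>_def using neg m0 by (intro divide_pos_pos) auto
  define V where "V = (\<lambda>y s. v y s + \<theta> * (s + m))"
  have "\<theta> * (t + m) \<le> \<theta> * (m + \<bar>t\<bar> + 1)" using \<theta> by (intro mult_left_mono) auto
  also have "\<dots> = - v x t / 2"
  proof -
    have "m + \<bar>t\<bar> + 1 \<noteq> 0" using m0 by linarith
    then show ?thesis by (simp add: \<theta>_def field_simps)
  qed
  finally have Vneg: "V x t < 0" using neg by (simp add: V_def)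
  have "continuous_on Z (\<lambda>z. V (fst z) (snd z))"
    unfolding V_def by (intro continuous_intros cont)
  then obtain z0 where z0: "z0 \<in> Z" "\<And>z. z \<in> Z \<Longrightarrow> V (fst z0) (snd z0) \<le> V (fst z) (snd z)"
    using continuous_attains_inf[OF Z, of "\<lambda>z. V (fst z) (snd z)"] z by blast
  obtain y s where ys: "z0 = (y, s)" by (cases z0)
  have inZ: "(y, s) \<in> Z" and le: "\<And>y' s'. (y', s') \<in> Z \<Longrightarrow> V y s \<le> V y' s'"
    using z0 ys by force+
  have "V y s < 0" using le[OF z] Vneg by linarith
  moreover have "0 \<le> \<theta> * (s + m)" using m[OF inZ] \<theta> by (intro mult_nonneg_nonneg) auto
  ultimately have vneg: "v y s < 0" by (simp add: V_def)
  obtain \<tau> p H a b where J: "parabolic_jet v y s \<tau> p H" "psd a" "0 \<le> \<tau> - a \<bullet> H + b \<bullet> p"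
    using super[OF inZ vneg] by blast
  have "\<forall>\<^sub>F y' in nhds y. v y s \<le> v y' s"
    using conjunct1[OF nbhd[OF inZ vneg]]
  proof eventually_elim
    case (elim y') then show ?case using le[OF elim] by (simp add: V_def)
  qed
  note jm = parabolic_jet_local_min[OF J(1) this]
  have "((\<lambda>s. V y s) has_real_derivative \<tau> + \<theta>) (at s)"
    using J(1) unfolding V_def parabolic_jet_def by (auto intro!: derivative_eq_intros)
  moreover have "\<forall>\<^sub>F s' in at_left s. V y s \<le> V y s'"
    using conjunct2[OF nbhd[OF inZ vneg]] by eventually_elim (rule le)
  \<comment> \<open>Zero gradient and \<open>0 \<le> a \<bullet> H\<close> turn the differential
    inequality into \<open>0 \<le> \<tau>\<close>, against this bound.\<close>
  ultimately have "\<tau> + \<theta> \<le> 0" by (rule DERIV_left_min)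
  moreover have "0 \<le> a \<bullet> H" using psd_inner_nonneg[OF J(2)] jm by blast
  ultimately show False using J(3) jm \<theta> by simp
qed

section \<open>The operator on a space-time cylinder\<close>

locale parabolic_operator =
  fixes \<Omega> :: "(real^'n) set" and T c C :: real
    and a :: "real^'n \<Rightarrow> real \<Rightarrow> real^'n^'n" and b :: "real^'n \<Rightarrow> real \<Rightarrow> real^'n"
  assumes open_\<Omega>: "open \<Omega>" and connected_\<Omega>: "connected \<Omega>" and bounded_\<Omega>: "bounded \<Omega>"
    and psd_a: "\<And>x t. x \<in> \<Omega> \<Longrightarrow> t \<in> {0<..<T} \<Longrightarrow> psd (a x t)"
    and elliptic: "\<And>x t \<xi>. x \<in> \<Omega> \<Longrightarrow> t \<in> {0<..<T} \<Longrightarrow> c * (\<xi> \<bullet> \<xi>) \<le> \<xi> \<bullet> (a x t *v \<xi>)"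
    and c_pos: "0 < c"
    and norm_a: "\<And>x t. x \<in> \<Omega> \<Longrightarrow> t \<in> {0<..<T} \<Longrightarrow> norm (a x t) \<le> C"
    and norm_b: "\<And>x t. x \<in> \<Omega> \<Longrightarrow> t \<in> {0<..<T} \<Longrightarrow> norm (b x t) \<le> C"
    and C_pos: "0 < C"
begin

lemma compact_cylinder: "compact (closure \<Omega> \<times> {r..s::real})"
  using bounded_\<Omega> by (intro compact_Times) (auto simp: compact_closure)

text \<open>Negative values occur only off the bottom and the lateral boundary, and there the
  spatial neighbours and slightly earlier times stay in the cylinder. Asking \<open>super\<close>
  only at negative values is what lets a monotone nonlinearity enter through its sign.\<close>

lemma minimum_principle_cylinder:
  fixes v :: "real^'n \<Rightarrow> real \<Rightarrow> real"
  assumes "t0 < T" and cont: "continuous_on (closure \<Omega> \<times> {0..t0}) (\<lambda>z. v (fst z) (snd z))"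
    and initial: "\<And>x. x \<in> closure \<Omega> \<Longrightarrow> 0 \<le> v x 0"
    and boundary: "\<And>x t. x \<in> frontier \<Omega> \<Longrightarrow> t \<in> {0..t0} \<Longrightarrow> 0 \<le> v x t"
    and super: "\<And>x t. x \<in> \<Omega> \<Longrightarrow> t \<in> {0<..t0} \<Longrightarrow> v x t < 0 \<Longrightarrow>
       \<exists>\<tau> p H. parabolic_jet v x t \<tau> p H \<and> 0 \<le> \<tau> - a x t \<bullet> H + b x t \<bullet> p"
    and x: "x \<in> closure \<Omega>" "t \<in> {0..t0}"
  shows "0 \<le> v x t"
proof (rule parabolic_minimum_principle[OF compact_cylinder cont])
  have interior: "x \<in> \<Omega>" "t \<in> {0<..t0}"
    if "(x, t) \<in> closure \<Omega> \<times> {0..t0}" "v x t < 0" for x t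
  proof -
    have "x \<notin> frontier \<Omega>" using that boundary[of x t] by fastforce
    then show "x \<in> \<Omega>" using that open_\<Omega> by (simp add: frontier_def interior_open)
    have "t \<noteq> 0" using that initial[of x] by fastforce
    then show "t \<in> {0<..t0}" using that by auto
  qed
  fix x t assume xt: "(x, t) \<in> closure \<Omega> \<times> {0..t0}" "v x t < 0"
  note i = interior[OF xt]
  have "\<forall>\<^sub>F y in nhds x. y \<in> \<Omega>" using i open_\<Omega> by (auto intro: eventually_nhds_in_open)
  then have "\<forall>\<^sub>F y in nhds x. (y, t) \<in> closure \<Omega> \<times> {0..t0}"
    by eventually_elim (use i closure_subset[of \<Omega>] in auto)
  moreover have "\<forall>\<^sub>F s in at_left t. (x, s) \<in> closure \<Omega> \<times> {0..t0}"
    using i closure_subset[of \<Omega>] by (intro eventually_at_leftI[of 0]) auto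
  ultimately show "(\<forall>\<^sub>F y in nhds x. (y, t) \<in> closure \<Omega> \<times> {0..t0}) \<and>
      (\<forall>\<^sub>F s in at_left t. (x, s) \<in> closure \<Omega> \<times> {0..t0})" ..
  show "\<exists>\<tau> p H a b. parabolic_jet v x t \<tau> p H \<and> psd a \<and> 0 \<le> \<tau> - a \<bullet> H + b \<bullet> p"
    using super[OF i xt(2)] psd_a[OF i(1), of t] i(2) \<open>t0 < T\<close> by force
qed (use x in auto)

end

section \<open>Strong minimum principle and Hopf lemma\<close>

text \<open>
  The barrier is the profile \<open>z + M z\<^sup>2\<close> of the function \<open>z\<close> below, which is positive exactly
  in a ball with moving centre and growing radius. The quadratic term makes it a subsolution near
  the lateral boundary \<open>z = 0\<close>, and the exponential damping does so away from it.
\<close>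

definition ball_profile :: "real^'n \<Rightarrow> real^'n \<Rightarrow> real \<Rightarrow> real \<Rightarrow> real \<Rightarrow> real^'n \<Rightarrow> real \<Rightarrow> real" where
  "ball_profile y v \<rho> \<eta> ts x t =
     \<rho> + \<eta> * (t - ts) - (x - (y + (t - ts) *\<^sub>R v)) \<bullet> (x - (y + (t - ts) *\<^sub>R v))"

lemma continuous_ball_profile:
  "continuous_on Z (\<lambda>z. ball_profile y v \<rho> \<eta> ts (fst z) (snd z))"
  unfolding ball_profile_def by (intro continuous_intros)

text \<open>The profile has time derivative \<open>\<eta> + 2 * (d \<bullet> v)\<close>, gradient -2
  d and Hessian -2 times the identity. Composition with \<open>z + M z\<^sup>2\<close> multiplies
  them by \<open>1 + 2 * M * z\<close> and adds 2 M times the square of the gradient, which is the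
  term \<open>(8 * M) *\<^sub>R outer d\<close>.\<close>

lemma parabolic_jet_barrier:
  fixes y v x :: "real^'n" and \<rho> \<eta> ts t K M :: real
  defines "z \<equiv> ball_profile y v \<rho> \<eta> ts" and "d \<equiv> x - (y + (t - ts) *\<^sub>R v)"
  shows "parabolic_jet (\<lambda>x t. exp (- K * (t - ts)) * (z x t + M * (z x t)\<^sup>2)) x t
     (exp (- K * (t - ts)) * (- K * (z x t + M * (z x t)\<^sup>2) + (1 + 2 * M * z x t) * (\<eta> + 2 * (d \<bullet> v))))
     (- (2 * exp (- K * (t - ts)) * (1 + 2 * M * z x t)) *\<^sub>R d)
     (exp (- K * (t - ts)) *\<^sub>R ((8 * M) *\<^sub>R outer d - (2 * (1 + 2 * M * z x t)) *\<^sub>R mat 1))"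
proof -
  let ?E = "exp (- K * (t - ts))"
  define D where "D = (\<lambda>x. x - (y + (t - ts) *\<^sub>R v))"
  have zt: "((\<lambda>s. z x s) has_real_derivative (\<eta> + 2 * (d \<bullet> v))) (at t)"
    unfolding z_def ball_profile_def has_field_derivative_def
    by (rule has_derivative_eq_rhs, (rule derivative_eq_intros refl)+)
       (auto simp: fun_eq_iff d_def inner_commute algebra_simps)
  have zx: "((\<lambda>x. z x t) has_derivative (\<lambda>h. - 2 * (D x \<bullet> h))) (at x)" for x
    unfolding z_def ball_profile_def D_def
    by (rule has_derivative_eq_rhs, (rule derivative_eq_intros refl)+)
       (auto simp: fun_eq_iff inner_commute algebra_simps)
  define P where "P = (\<lambda>x. - (2 * ?E * (1 + 2 * M * z x t)) *\<^sub>R D x)"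
  have Dd: "D x = d" by (simp add: D_def d_def)
  have D': "(D has_derivative (\<lambda>h. h)) (at x)"
    unfolding D_def by (auto intro!: derivative_eq_intros)
  show ?thesis unfolding parabolic_jet_def
  proof (intro conjI exI[of _ P] always_eventually allI)
    show "((\<lambda>s. exp (- K * (s - ts)) * (z x s + M * (z x s)\<^sup>2)) has_real_derivative
        ?E * (- K * (z x t + M * (z x t)\<^sup>2) + (1 + 2 * M * z x t) * (\<eta> + 2 * (d \<bullet> v)))) (at t)"
      by (rule derivative_eq_intros zt refl)+ (simp add: algebra_simps)
    show "((\<lambda>y. ?E * (z y t + M * (z y t)\<^sup>2)) has_derivative (\<lambda>h. P x' \<bullet> h)) (at x')" for x'
      by (rule has_derivative_eq_rhs, (rule derivative_eq_intros zx refl)+)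
         (auto simp: fun_eq_iff P_def algebra_simps)
    show "P x = - (2 * ?E * (1 + 2 * M * z x t)) *\<^sub>R d" by (simp add: P_def Dd)
    have *: "(P has_derivative (\<lambda>h. - (2 * ?E * (1 + 2 * M * z x t)) *\<^sub>R h
        + (- (2 * ?E * (2 * M * (- 2 * (D x \<bullet> h))))) *\<^sub>R D x)) (at x)"
      unfolding P_def
      by (rule has_derivative_eq_rhs, (rule derivative_eq_intros zx D' refl)+) (auto simp: fun_eq_iff)
    have **: "(?E *\<^sub>R ((8 * M) *\<^sub>R outer d - (2 * (1 + 2 * M * z x t)) *\<^sub>R mat 1)) *v h
       = - (2 * ?E * (1 + 2 * M * z x t)) *\<^sub>R h + (- (2 * ?E * (2 * M * (- 2 * (D x \<bullet> h))))) *\<^sub>R D x" for h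
      by (simp add: Dd scaleR_matrix_vector_assoc[symmetric] matrix_vector_mult_diff_rdistrib
          outer_mult_vec scaleR_diff_right algebra_simps)
    show "(P has_derivative (\<lambda>h. (?E *\<^sub>R ((8 * M) *\<^sub>R outer d
        - (2 * (1 + 2 * M * z x t)) *\<^sub>R mat 1)) *v h)) (at x)"
      using * unfolding ** .
  qed
qed

text \<open>The term \<open>- Q * w x t\<close> makes room for the Lipschitz constant of a
  nonlinearity.\<close>

locale parabolic_supersolution = parabolic_operator +
  fixes w :: "real^'n \<Rightarrow> real \<Rightarrow> real" and Q t0 :: real
  assumes t0_less: "t0 < T" and Q: "0 \<le> Q"
    and cont: "continuous_on (closure \<Omega> \<times> {0..t0}) (\<lambda>z. w (fst z) (snd z))"
    and nonneg: "\<And>x t. x \<in> closure \<Omega> \<Longrightarrow> t \<in> {0..t0} \<Longrightarrow> 0 \<le> w x t"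
    and super: "\<And>x t. x \<in> \<Omega> \<Longrightarrow> t \<in> {0<..t0} \<Longrightarrow>
       \<exists>\<tau> p H. parabolic_jet w x t \<tau> p H \<and> - Q * w x t \<le> \<tau> - a x t \<bullet> H + b x t \<bullet> p"

text \<open>\<open>C0\<close> bounds the terms without a definite sign. By ellipticity the rank one
  term is at least \<open>8 * M * c * (\<rho>1 - z)\<close>, and \<open>M\<close> is chosen so that
  this equals \<open>C0 - 8 * M * c * z\<close>. What is left over is proportional to
  \<open>z\<close> and absorbed by the damping \<open>K\<close>, whose summand \<open>Q\<close>
  supplies the zero-order term.\<close>

lemma (in parabolic_operator) barrier_inequality:
  fixes d v :: "real^'n" and z \<rho> \<rho>1 \<eta> D C0 E Q :: real
  defines "M \<equiv> C0 / (8 * c * \<rho>1)"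
  defines "K \<equiv> Q + 2 * M * C0 + 8 * M * c"
  assumes x: "x \<in> \<Omega>" "t \<in> {0<..<T}"
    and C0: "\<eta> + 2 * D * norm v + 2 * C * norm (mat 1 :: real^'n^'n) + 2 * C * D \<le> C0" "0 \<le> C0"
    and d: "d \<bullet> d = \<rho> - z" "norm d \<le> D" and z: "0 \<le> z" and \<rho>: "0 < \<rho>1" "\<rho>1 \<le> \<rho>"
    and E: "0 \<le> E" and Q: "0 \<le> Q"
  shows "E * (- K * (z + M * z\<^sup>2) + (1 + 2 * M * z) * (\<eta> + 2 * (d \<bullet> v)))
       - a x t \<bullet> (E *\<^sub>R ((8 * M) *\<^sub>R outer d - (2 * (1 + 2 * M * z)) *\<^sub>R mat 1))
       + b x t \<bullet> (- (2 * E * (1 + 2 * M * z)) *\<^sub>R d) \<le> - Q * (E * (z + M * z\<^sup>2))"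
proof -
  have M: "M \<ge> 0" using C0 c_pos \<rho> by (simp add: M_def)
  have D: "0 \<le> D" using d(2) norm_ge_zero order_trans by blast
  have "d \<bullet> v \<le> D * norm v"
    using norm_cauchy_schwarz[of d v] mult_right_mono[OF d(2), of "norm v"] by simp
  moreover have "a x t \<bullet> mat 1 \<le> C * norm (mat 1 :: real^'n^'n)"
    using norm_cauchy_schwarz[of "a x t" "mat 1"]
      mult_right_mono[OF norm_a[OF x], of "norm (mat 1 :: real^'n^'n)"] by simp
  moreover have "- (b x t \<bullet> d) \<le> C * D"
    using Cauchy_Schwarz_ineq2[of "b x t" d] mult_mono[OF norm_b[OF x] d(2)] C_pos by simp
  ultimately have X: "\<eta> + 2 * (d \<bullet> v) + 2 * (a x t \<bullet> mat 1) - 2 * (b x t \<bullet> d) \<le> C0"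
    using C0 by argo
  have "c * (\<rho>1 - z) \<le> c * (\<rho> - z)" using \<rho> c_pos by simp
  also have "\<dots> \<le> d \<bullet> (a x t *v d)" using elliptic[OF x, of d] d(1) by simp
  finally have "8 * M * (c * (\<rho>1 - z)) \<le> 8 * M * (d \<bullet> (a x t *v d))"
    using M by (intro mult_left_mono) auto
  moreover have "8 * M * (c * (\<rho>1 - z)) = C0 - 8 * M * c * z"
    using c_pos \<rho> by (simp add: M_def field_simps)
  ultimately have Y: "C0 - 8 * M * c * z \<le> 8 * M * (d \<bullet> (a x t *v d))" by simp
  have Z: "(1 + 2 * M * z) * (\<eta> + 2 * (d \<bullet> v) + 2 * (a x t \<bullet> mat 1) - 2 * (b x t \<bullet> d))
      \<le> (1 + 2 * M * z) * C0"
    using X M z by (intro mult_left_mono) auto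
  have "(K - Q) * z \<le> (K - Q) * (z + M * z\<^sup>2)"
    using M c_pos C0 by (intro mult_left_mono) (auto simp: K_def)
  moreover have "(1 + 2 * M * z) * C0 - (C0 - 8 * M * c * z) = (K - Q) * z"
    by (simp add: K_def algebra_simps)
  ultimately have "- K * (z + M * z\<^sup>2)
      + (1 + 2 * M * z) * (\<eta> + 2 * (d \<bullet> v) + 2 * (a x t \<bullet> mat 1) - 2 * (b x t \<bullet> d))
      - 8 * M * (d \<bullet> (a x t *v d)) \<le> - Q * (z + M * z\<^sup>2)"
    using Y Z by (simp add: left_diff_distrib)
  then have "E * (- K * (z + M * z\<^sup>2)
      + (1 + 2 * M * z) * (\<eta> + 2 * (d \<bullet> v) + 2 * (a x t \<bullet> mat 1) - 2 * (b x t \<bullet> d))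
      - 8 * M * (d \<bullet> (a x t *v d))) \<le> E * (- Q * (z + M * z\<^sup>2))"
    using E by (rule mult_left_mono)
  then show ?thesis
    by (simp add: inner_diff_right inner_outer algebra_simps)
qed

context parabolic_supersolution
begin

text \<open>A small multiple of the barrier \<open>h\<close> lies below \<open>w\<close> at the
  start, where \<open>w\<close> has a positive minimum, and on the lateral boundary of the region
  \<open>0 \<le> z\<close>, where \<open>h\<close> vanishes and \<open>w\<close> is nonnegative. The
  minimum principle carries this inside.\<close>

lemma ball_barrier:
  fixes y v :: "real^'n" and \<rho> \<eta> ts :: real
  defines "z \<equiv> ball_profile y v \<rho> \<eta> ts"
  assumes ts: "0 < ts" "ts \<le> t0" and \<rho>: "0 < \<rho>" and \<eta>: "0 \<le> \<eta>"
    and inside: "\<And>x t. t \<in> {ts..t0} \<Longrightarrow> 0 < z x t \<Longrightarrow> x \<in> \<Omega>"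
    and inside_closure: "\<And>x t. t \<in> {ts..t0} \<Longrightarrow> 0 \<le> z x t \<Longrightarrow> x \<in> closure \<Omega>"
    and initial: "\<And>x. 0 \<le> z x ts \<Longrightarrow> 0 < w x ts"
  shows "\<exists>\<epsilon>>0. \<forall>x. \<forall>t\<in>{ts..t0}. 0 \<le> z x t \<longrightarrow> \<epsilon> * z x t \<le> w x t"
proof -
  have contz: "continuous_on Z (\<lambda>q. z (fst q) (snd q))" for Z
    unfolding z_def by (rule continuous_ball_profile)
  \<comment> \<open>The squared distance to the moving centre is at most \<open>D - 1\<close>; since
    \<open>D \<ge> 1\<close>, the distance itself is at most \<open>D\<close>.\<close>
  define D where "D = 1 + \<rho> + \<eta> * (t0 - ts)"
  define C0 where "C0 = \<eta> + 2 * D * norm v + 2 * C * norm (mat 1 :: real^'n^'n) + 2 * C * D"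
  define M where "M = C0 / (8 * c * \<rho>)"
  define K where "K = Q + 2 * M * C0 + 8 * M * c"
  define h where "h = (\<lambda>x t. exp (- K * (t - ts)) * (z x t + M * (z x t)\<^sup>2))"
  have D0: "0 \<le> D" using \<rho> \<eta> ts by (simp add: D_def)
  have C00: "0 \<le> C0" using \<eta> D0 C_pos by (simp add: C0_def)
  have M0: "0 \<le> M" using C00 c_pos \<rho> by (simp add: M_def)
  have K0: "0 \<le> K" using Q M0 C00 c_pos by (simp add: K_def)
  have conth: "continuous_on Z (\<lambda>q. h (fst q) (snd q))" for Z
    unfolding h_def by (intro continuous_intros contz)
  define Z where "Z = closure \<Omega> \<times> {ts..t0} \<inter> {q. 0 \<le> z (fst q) (snd q)}"
  have compact: "compact Z" unfolding Z_def
    by (intro compact_Int_closed compact_cylinder closed_Collect_le continuous_on_const contz)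
  have Zsub: "Z \<subseteq> closure \<Omega> \<times> {0..t0}" using ts by (auto simp: Z_def)
  note contw = continuous_on_subset[OF cont Zsub]
  have inZ: "(x, t) \<in> Z \<longleftrightarrow> t \<in> {ts..t0} \<and> 0 \<le> z x t" for x t
    using inside_closure by (auto simp: Z_def)
  have zle: "z x t \<le> \<rho> + \<eta> * (t - ts)" for x t by (simp add: z_def ball_profile_def)
  have zy: "z y ts = \<rho>" by (simp add: z_def ball_profile_def)
  obtain m where m: "m > 0" "\<And>x. 0 \<le> z x ts \<Longrightarrow> m \<le> w x ts"
  proof -
    let ?Z = "Z \<inter> (UNIV \<times> {ts})"
    have "compact ?Z" using compact by (intro compact_Int_closed closed_Times) auto
    moreover have "(y, ts) \<in> ?Z" using ts \<rho> by (auto simp: inZ zy)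
    moreover have "continuous_on ?Z (\<lambda>q. w (fst q) (snd q))"
      using contw by (rule continuous_on_subset) auto
    ultimately obtain q where q: "q \<in> ?Z" "\<And>q'. q' \<in> ?Z \<Longrightarrow> w (fst q) (snd q) \<le> w (fst q') (snd q')"
      using continuous_attains_inf[of ?Z "\<lambda>q. w (fst q) (snd q)"] by blast
    obtain x where x: "q = (x, ts)" "(x, ts) \<in> Z" using q(1) by auto
    show thesis
    proof (rule that)
      show "0 < w x ts" using x initial by (auto simp: inZ)
      fix x' assume "0 \<le> z x' ts"
      then have "(x', ts) \<in> ?Z" using ts by (auto simp: inZ)
      from q(2)[OF this] show "w x ts \<le> w x' ts" by (simp add: x)
    qed
  qed
  \<comment> \<open>At time \<open>ts\<close> one has \<open>z \<le> \<rho>\<close>, so the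
    denominator bounds \<open>h\<close> and \<open>\<epsilon> * h\<close> stays below the minimum
    \<open>m\<close> of \<open>w\<close>.\<close>
  define \<epsilon> where "\<epsilon> = m / (\<rho> + M * \<rho>\<^sup>2)"
  have \<rho>M: "0 < \<rho> + M * \<rho>\<^sup>2" using \<rho> M0 by (intro add_pos_nonneg) auto
  have \<epsilon>: "\<epsilon> > 0" using m(1) \<rho>M by (simp add: \<epsilon>_def)
  have main: "0 \<le> w x t - \<epsilon> * h x t" if "(x, t) \<in> Z" for x t
  proof (rule parabolic_minimum_principle[where v = "\<lambda>x t. w x t - \<epsilon> * h x t", OF compact])
    show "continuous_on Z (\<lambda>q. w (fst q) (snd q) - \<epsilon> * h (fst q) (snd q))"
      by (intro continuous_intros contw conth)
    show "(x, t) \<in> Z" by fact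
    fix x t assume xt: "(x, t) \<in> Z" "w x t - \<epsilon> * h x t < 0"
    have xO: "x \<in> closure \<Omega>" and t: "t \<in> {ts..t0}" and z0: "0 \<le> z x t" using xt by (auto simp: Z_def)
    have w0: "0 \<le> w x t" using nonneg xO t ts by auto
    have "z x t \<noteq> 0" using xt(2) w0 by (auto simp: h_def)
    then have zpos: "0 < z x t" using z0 by simp
    have "t \<noteq> ts"
    proof
      assume tts: "t = ts"
      have zb: "z x t \<le> \<rho>" using zle[of x t] tts by simp
      have "(z x t)\<^sup>2 \<le> \<rho>\<^sup>2" using zb z0 by (intro power_mono)
      then have "h x t \<le> \<rho> + M * \<rho>\<^sup>2"
        using zb M0 tts unfolding h_def by (auto intro!: add_mono mult_left_mono)
      then have "\<epsilon> * h x t \<le> m"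
        using \<epsilon> \<rho>M mult_left_mono[of "h x t" "\<rho> + M * \<rho>\<^sup>2" \<epsilon>] by (simp add: \<epsilon>_def)
      moreover have "m \<le> w x t" using m(2) z0 tts by blast
      ultimately show False using xt(2) by simp
    qed
    then have t': "ts < t" "t \<le> t0" using t by auto
    have x\<Omega>: "x \<in> \<Omega>" using inside[OF t zpos] .
    have contx: "continuous_on UNIV (\<lambda>x. z x t)" "continuous_on UNIV (\<lambda>t. z x t)"
      unfolding z_def ball_profile_def by (intro continuous_intros)+
    have "\<forall>\<^sub>F y in nhds x. 0 < z y t"
      using open_Collect_less[OF continuous_on_const contx(1), of 0] zpos
      by (auto dest: eventually_nhds_in_open)
    then have "\<forall>\<^sub>F y in nhds x. (y, t) \<in> Z"
      by eventually_elim (use t in \<open>auto simp: inZ\<close>)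
    moreover have "\<forall>\<^sub>F s in nhds t. 0 < z x s"
      using open_Collect_less[OF continuous_on_const contx(2), of 0] zpos
      by (auto dest: eventually_nhds_in_open)
    then have "\<forall>\<^sub>F s in at_left t. 0 < z x s"
      by (simp add: eventually_at_filter eventually_mono)
    moreover have "\<forall>\<^sub>F s in at_left t. s \<in> {ts..t0}"
      using t' by (intro eventually_at_leftI[of ts]) auto
    ultimately show "(\<forall>\<^sub>F y in nhds x. (y, t) \<in> Z) \<and> (\<forall>\<^sub>F s in at_left t. (x, s) \<in> Z)"
      by (auto simp: inZ elim: eventually_elim2)
    have tT: "t \<in> {0<..<T}" and t0': "t \<in> {0<..t0}" using t' ts t0_less by auto
    obtain \<tau> p H where J: "parabolic_jet w x t \<tau> p H"
        "- Q * w x t \<le> \<tau> - a x t \<bullet> H + b x t \<bullet> p"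
      using super[OF x\<Omega> t0'] by blast
    define d where "d = x - (y + (t - ts) *\<^sub>R v)"
    define E where "E = exp (- K * (t - ts))"
    define \<tau>' where "\<tau>' = E * (- K * (z x t + M * (z x t)\<^sup>2) + (1 + 2 * M * z x t) * (\<eta> + 2 * (d \<bullet> v)))"
    define p' where "p' = - (2 * E * (1 + 2 * M * z x t)) *\<^sub>R d"
    define H' where "H' = E *\<^sub>R ((8 * M) *\<^sub>R outer d - (2 * (1 + 2 * M * z x t)) *\<^sub>R mat 1)"
    have J': "parabolic_jet h x t \<tau>' p' H'"
      unfolding h_def \<tau>'_def p'_def H'_def E_def d_def z_def by (rule parabolic_jet_barrier)
    have dd: "d \<bullet> d = (\<rho> + \<eta> * (t - ts)) - z x t"
      by (simp add: z_def ball_profile_def d_def)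
    have "\<eta> * (t - ts) \<le> \<eta> * (t0 - ts)" using \<eta> t' by (intro mult_left_mono) auto
    then have "(norm d)\<^sup>2 \<le> D - 1" using dd z0 by (simp add: D_def dot_square_norm)
    also have "\<dots> \<le> D\<^sup>2"
    proof -
      have "D \<ge> 1" using \<rho> \<eta> ts by (simp add: D_def)
      then have "D * 1 \<le> D * D" by (intro mult_left_mono) auto
      then show ?thesis by (simp add: power2_eq_square)
    qed
    finally have dD: "norm d \<le> D" using D0 by (rule power2_le_imp_le)
    have "\<tau>' - a x t \<bullet> H' + b x t \<bullet> p' \<le> - Q * (E * (z x t + M * (z x t)\<^sup>2))"
      unfolding \<tau>'_def H'_def p'_def K_def M_def
      by (rule barrier_inequality[OF x\<Omega> tT _ C00 dd dD z0 \<rho> _ _ Q])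
         (use \<eta> t' in \<open>auto simp: C0_def E_def\<close>)
    then have "\<tau>' - a x t \<bullet> H' + b x t \<bullet> p' \<le> - Q * h x t" by (simp add: h_def E_def)
    then have "\<epsilon> * (\<tau>' - a x t \<bullet> H' + b x t \<bullet> p') \<le> \<epsilon> * (- Q * h x t)"
      using \<epsilon> by (intro mult_left_mono) auto
    \<comment> \<open>The zero-order terms combine with the right sign because the difference is
      negative at this point.\<close>
    moreover have "- Q * (w x t - \<epsilon> * h x t) \<ge> 0"
      using Q xt(2) by (simp add: mult_nonneg_nonpos)
    ultimately have "0 \<le> (\<tau> - \<epsilon> * \<tau>') - a x t \<bullet> (H - \<epsilon> *\<^sub>R H') + b x t \<bullet> (p - \<epsilon> *\<^sub>R p')"
      using J(2) by (simp add: inner_diff_right algebra_simps)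
    moreover have "parabolic_jet (\<lambda>x t. w x t - \<epsilon> * h x t) x t (\<tau> - \<epsilon> * \<tau>') (p - \<epsilon> *\<^sub>R p') (H - \<epsilon> *\<^sub>R H')"
      by (intro parabolic_jet_diff parabolic_jet_scale J J')
    ultimately show "\<exists>\<tau> p H a b. parabolic_jet (\<lambda>x t. w x t - \<epsilon> * h x t) x t \<tau> p H \<and> psd a \<and>
        0 \<le> \<tau> - a \<bullet> H + b \<bullet> p"
      using psd_a[OF x\<Omega> tT] by blast
  qed
  show ?thesis
  \<comment> \<open>The exponential is replaced by its smallest value, attained at
    \<open>t0\<close>, and the quadratic term is dropped.\<close>
  proof (intro exI[of _ "\<epsilon> * exp (- K * (t0 - ts))"] conjI allI ballI impI)
    show "0 < \<epsilon> * exp (- K * (t0 - ts))" using \<epsilon> by simp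
    fix x t assume t: "t \<in> {ts..t0}" and z0: "0 \<le> z x t"
    have "exp (- K * (t0 - ts)) * z x t \<le> exp (- K * (t - ts)) * (z x t + M * (z x t)\<^sup>2)"
      using K0 M0 t z0 by (intro mult_mono) (auto intro!: mult_left_mono)
    then have "\<epsilon> * (exp (- K * (t0 - ts)) * z x t) \<le> \<epsilon> * h x t"
      unfolding h_def using \<epsilon> by (intro mult_left_mono) auto
    also have "\<dots> \<le> w x t" using main[of x t] t z0 by (simp add: inZ)
    finally show "\<epsilon> * exp (- K * (t0 - ts)) * z x t \<le> w x t" by (simp add: mult.assoc)
  qed
qed

text \<open>A ball of constant radius travels with constant velocity from \<open>x\<close> to
  \<open>y\<close>; any positive lapse of time will do, as the velocity may be large. By convexity
  its centre stays in \<open>ball x0 r\<close>, and its radius is at most \<open>r\<close>.\<close>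

lemma positivity_local:
  assumes ball: "ball x0 (4 * r) \<subseteq> \<Omega>" and xy: "x \<in> ball x0 r" "y \<in> ball x0 r"
    and t: "0 < t" "t < t'" "t' \<le> t0" and pos: "0 < w x t"
  shows "0 < w y t'"
proof -
  have r: "r > 0" using xy by (auto intro: le_less_trans[OF zero_le_dist])
  have xcl: "z \<in> \<Omega>" if "dist x0 z < 4 * r" for z using ball that by auto
  have "continuous_on (ball x0 (4 * r)) (\<lambda>x. w x t)"
    by (rule continuous_on_compose2[OF cont, of _ "\<lambda>x. (x, t)", simplified])
       (use t ball closure_subset in \<open>auto intro!: continuous_intros\<close>)
  then have "isCont (\<lambda>x. w x t) x"
    using xy r by (auto simp: continuous_on_eq_continuous_at)
  then have "\<forall>\<^sub>F z in nhds x. 0 < w z t"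
    using pos by (metis isCont_def tendsto_at_iff_tendsto_nhds order_tendstoD(1))
  then obtain e where e: "e > 0" "\<And>z. dist z x < e \<Longrightarrow> 0 < w z t"
    by (auto simp: eventually_nhds_metric)
  define s where "s = min (e / 2) r"
  have s: "0 < s" "s < e" "s \<le> r" using e r by (auto simp: s_def)
  define v where "v = (1 / (t' - t)) *\<^sub>R (y - x)"
  define z where "z = ball_profile x v (s\<^sup>2) 0 t"
  \<comment> \<open>The top time is lowered to \<open>t'\<close>, since later the ball might leave
    the domain.\<close>
  interpret S: parabolic_supersolution \<Omega> T c C a b w Q t'
  proof
    show "continuous_on (closure \<Omega> \<times> {0..t'}) (\<lambda>z. w (fst z) (snd z))"
      using cont by (rule continuous_on_subset) (use t in auto)
  qed (use t t0_less Q nonneg super in auto)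
  have in_ball: "q \<in> \<Omega>" if "\<tau> \<in> {t..t'}" "0 \<le> z q \<tau>" for q \<tau>
  proof -
    define l where "l = (\<tau> - t) / (t' - t)"
    have l: "0 \<le> l" "l \<le> 1" using that t by (auto simp: l_def)
    have "(\<tau> - t) *\<^sub>R v = l *\<^sub>R (y - x)" by (simp add: v_def l_def)
    then have "(norm (q - (x + l *\<^sub>R (y - x))))\<^sup>2 \<le> s\<^sup>2"
      using that(2) by (simp add: z_def ball_profile_def dot_square_norm)
    then have "norm (q - (x + l *\<^sub>R (y - x))) \<le> s" using s by (simp add: power2_le_iff_abs_le)
    moreover have "x + l *\<^sub>R (y - x) \<in> ball x0 r"
      using convexD_alt[OF convex_ball xy l] by (simp add: algebra_simps)
    ultimately have "dist x0 q < 4 * r"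
      using dist_triangle[of x0 q "x + l *\<^sub>R (y - x)"] s r
      by (simp add: dist_norm norm_minus_commute)
    then show ?thesis by (rule xcl)
  qed
  have "\<exists>\<epsilon>>0. \<forall>q. \<forall>\<tau>\<in>{t..t'}. 0 \<le> z q \<tau> \<longrightarrow> \<epsilon> * z q \<tau> \<le> w q \<tau>"
    unfolding z_def
  proof (rule S.ball_barrier, fold z_def)
    fix q assume "0 \<le> z q t"
    then have "(norm (q - x))\<^sup>2 \<le> s\<^sup>2" by (simp add: z_def ball_profile_def dot_square_norm)
    then have "norm (q - x) \<le> s" using s by (simp add: power2_le_iff_abs_le)
    then show "0 < w q t" using e(2)[of q] s by (simp add: dist_norm)
  qed (use t s in_ball closure_subset in auto)
  then obtain \<epsilon> where \<epsilon>: "\<epsilon> > 0" "\<And>q. 0 \<le> z q t' \<Longrightarrow> \<epsilon> * z q t' \<le> w q t'"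
    using t by auto
  have "z y t' = s\<^sup>2" using t by (simp add: z_def ball_profile_def v_def)
  then show ?thesis using \<epsilon>(1) \<epsilon>(2)[of y] s by (smt (verit) zero_less_power mult_pos_pos)
qed

text \<open>Local steps are chained over the connected domain. Each of them costs time, so the
  propagated property \<open>P\<close> speaks of all times after \<open>t1\<close>: an arbitrarily
  small part of the elapsed time can be spent on each step.\<close>

lemma positivity:
  assumes x: "x1 \<in> \<Omega>" "y \<in> \<Omega>" and t: "0 < t1" "t1 < t" "t \<le> t0" and pos: "0 < w x1 t1"
  shows "0 < w y t"
proof -
  define P where "P = (\<lambda>x. \<forall>t\<in>{t1<..t0}. 0 < w x t)"
  have nb: thesis
    if "a \<in> \<Omega>" and hyp: "\<And>r. r > 0 \<Longrightarrow> ball a r \<subseteq> \<Omega> \<Longrightarrow>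
      (\<And>x y s t. x \<in> ball a r \<Longrightarrow> y \<in> ball a r \<Longrightarrow> 0 < s \<Longrightarrow> s < t \<Longrightarrow> t \<le> t0 \<Longrightarrow> 0 < w x s \<Longrightarrow> 0 < w y t)
      \<Longrightarrow> thesis" for a thesis
  proof -
    obtain r where r: "r > 0" "ball a r \<subseteq> \<Omega>" using open_\<Omega> \<open>a \<in> \<Omega>\<close> openE by blast
    have "ball a (r / 4) \<subseteq> ball a r" using r by (intro subset_ball) auto
    with r have sub: "ball a (r / 4) \<subseteq> \<Omega>" by blast
    show thesis
    proof (rule hyp[OF _ sub])
      fix x y s t
      assume "x \<in> ball a (r / 4)" "y \<in> ball a (r / 4)" "0 < s" "s < t" "t \<le> t0" "0 < w x s"
      then show "0 < w y t" using r by - (rule positivity_local[of a "r / 4" x y s t], auto)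
    qed (use r in auto)
  qed
  have "P x1"
    unfolding P_def
  proof
    fix t assume "t \<in> {t1<..t0}"
    then show "0 < w x1 t" using nb[OF x(1)] t(1) pos by (metis centre_in_ball greaterThanAtMost_iff)
  qed
  have "P y"
  proof (rule connected_induction_simple[where P = P, OF connected_\<Omega> x(1) x(2) \<open>P x1\<close>])
    fix a assume "a \<in> \<Omega>"
    then show "\<exists>T. openin (top_of_set \<Omega>) T \<and> a \<in> T \<and> (\<forall>x\<in>T. \<forall>y\<in>T. P x \<longrightarrow> P y)"
    proof (rule nb)
      fix r
      assume r: "r > 0" "ball a r \<subseteq> \<Omega>"
        "\<And>x y s t. x \<in> ball a r \<Longrightarrow> y \<in> ball a r \<Longrightarrow> 0 < s \<Longrightarrow> s < t \<Longrightarrow> t \<le> t0 \<Longrightarrow> 0 < w x s \<Longrightarrow> 0 < w y t"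
      show ?thesis
      proof (intro exI[of _ "ball a r"] conjI ballI impI)
        show "openin (top_of_set \<Omega>) (ball a r)" using r by (simp add: openin_open_eq open_\<Omega>)
        fix x y assume xy: "x \<in> ball a r" "y \<in> ball a r" "P x"
        show "P y" unfolding P_def
        proof
          fix t assume t': "t \<in> {t1<..t0}"
          \<comment> \<open>The second half of the time since \<open>t1\<close> is kept for the
            passage from \<open>x\<close> to \<open>y\<close>.\<close>
          then have "0 < w x ((t1 + t) / 2)" using xy(3) by (auto simp: P_def)
          then show "0 < w y t" using r(3)[OF xy(1,2), of "(t1 + t) / 2" t] t' t by auto
        qed
      qed (use r in auto)
    qed
  qed
  then show ?thesis using t by (auto simp: P_def)
qed

text \<open>
  The growing ball reaches the sphere of radius \<open>r\<close> only at the final time, so positivity on a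
  smaller concentric ball inside \<open>\<Omega>\<close> suffices at the start.
\<close>

lemma hopf_growth:
  assumes ball: "ball y r \<subseteq> \<Omega>" and r: "0 < r" and x1: "x1 \<in> \<Omega>" "0 < t1" "t1 < t0" "0 < w x1 t1"
  shows "\<exists>\<epsilon>>0. \<forall>x\<in>cball y r. \<epsilon> * (r\<^sup>2 - (norm (x - y))\<^sup>2) \<le> w x t0"
proof -
  \<comment> \<open>Positivity spreads over the domain between \<open>t1\<close> and
    \<open>ts\<close>; the ball grows between \<open>ts\<close> and \<open>t0\<close>.\<close>
  define ts where "ts = (t1 + t0) / 2"
  have ts: "t1 < ts" "ts < t0" using x1 by (auto simp: ts_def)
  \<comment> \<open>With this rate the squared radius grows from \<open>r\<^sup>2 / 4\<close> to
    exactly \<open>r\<^sup>2\<close>.\<close>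
  define \<eta> where "\<eta> = (3 / 4 * r\<^sup>2) / (t0 - ts)"
  define z where "z = ball_profile y 0 (r\<^sup>2 / 4) \<eta> ts"
  have \<eta>: "0 \<le> \<eta>" using ts by (simp add: \<eta>_def)
  have zt0: "z x t0 = r\<^sup>2 - (norm (x - y))\<^sup>2" for x
  proof -
    have "t0 - ts \<noteq> 0" using ts by simp
    then have "\<eta> * (t0 - ts) = 3 / 4 * r\<^sup>2" unfolding \<eta>_def by (rule nonzero_eq_divide_eq[THEN iffD1]) simp
    then show ?thesis by (simp add: z_def ball_profile_def dot_square_norm)
  qed
  have zle: "z x t \<le> r\<^sup>2 - (norm (x - y))\<^sup>2" if "t \<in> {ts..t0}" for x t
  proof -
    have "z x t \<le> z x t0"
      using that \<eta> by (auto simp: z_def ball_profile_def intro!: mult_left_mono)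
    then show ?thesis by (simp add: zt0)
  qed
  have ballI: "x \<in> \<Omega>" if "(norm (x - y))\<^sup>2 < r\<^sup>2" for x
  proof -
    have "norm (x - y) < r" using that r by (simp add: power2_less_imp_less)
    then show ?thesis using ball by (auto simp: dist_norm norm_minus_commute)
  qed
  have clI: "x \<in> closure \<Omega>" if "(norm (x - y))\<^sup>2 \<le> r\<^sup>2" for x
  proof -
    have "norm (x - y) \<le> r" using power2_le_imp_le[OF that] r by simp
    then have "x \<in> closure (ball y r)" using r by (simp add: dist_norm norm_minus_commute)
    then show ?thesis using closure_mono[OF ball] by blast
  qed
  have "\<exists>\<epsilon>>0. \<forall>x. \<forall>t\<in>{ts..t0}. 0 \<le> z x t \<longrightarrow> \<epsilon> * z x t \<le> w x t"
    unfolding z_def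
  proof (rule ball_barrier, fold z_def)
    fix x assume "0 \<le> z x ts"
    then have "(norm (x - y))\<^sup>2 \<le> r\<^sup>2 / 4" by (simp add: z_def ball_profile_def dot_square_norm)
    also have "\<dots> < r\<^sup>2" using r by simp
    finally have "x \<in> \<Omega>" by (rule ballI)
    then show "0 < w x ts" using positivity[OF x1(1) _ x1(2) ts(1)] ts x1(4) by simp
  next
    fix x t assume "t \<in> {ts..t0}" "0 < z x t"
    with zle[of t x] show "x \<in> \<Omega>" by (intro ballI) auto
  next
    fix x t assume "t \<in> {ts..t0}" "0 \<le> z x t"
    with zle[of t x] show "x \<in> closure \<Omega>" by (intro clI) auto
  qed (use ts x1 r \<eta> in auto)
  then obtain \<epsilon> where \<epsilon>: "\<epsilon> > 0" "\<And>x. 0 \<le> z x t0 \<Longrightarrow> \<epsilon> * z x t0 \<le> w x t0"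
    using ts by auto
  have "\<epsilon> * (r\<^sup>2 - (norm (x - y))\<^sup>2) \<le> w x t0" if "x \<in> cball y r" for x
  proof -
    have "(norm (x - y))\<^sup>2 \<le> r\<^sup>2"
      using that by (intro power_mono) (auto simp: dist_norm norm_minus_commute)
    then show ?thesis using \<epsilon>(2)[of x] by (simp add: zt0)
  qed
  with \<epsilon>(1) show ?thesis by blast
qed

end

text \<open>The direction \<open>- q\<close> may be oblique to the sphere, but it enters the ball
  because \<open>0 < n \<bullet> q\<close>, and along it the lower bound on \<open>w\<close> grows
  linearly. The direction needed later is the conormal one.\<close>

lemma boundary_slope_negative:
  fixes w :: "'a::real_inner \<Rightarrow> real"
  assumes D: "(w has_derivative (\<lambda>h. G \<bullet> h)) (at x within K)" and K: "cball y r \<subseteq> K"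
    and r: "0 < r" and n: "x - y = r *\<^sub>R n" "norm n = 1" "0 < n \<bullet> q" and x: "w x = 0"
    and \<epsilon>: "0 < \<epsilon>" "\<And>z. z \<in> cball y r \<Longrightarrow> \<epsilon> * (r\<^sup>2 - (norm (z - y))\<^sup>2) \<le> w z"
  shows "G \<bullet> q < 0"
proof -
  have nn: "n \<bullet> n = 1" using n(2) by (simp add: dot_square_norm)
  have q: "q \<noteq> 0" using n(3) by auto
  \<comment> \<open>Up to this length the quadratic loss \<open>s\<^sup>2 * (q \<bullet> q)\<close>
    uses up at most half of the linear gain \<open>2 * s * (r * (n \<bullet> q))\<close>.\<close>
  define \<delta> where "\<delta> = r * (n \<bullet> q) / (q \<bullet> q)"
  have \<delta>: "0 < \<delta>" using r n(3) q by (simp add: \<delta>_def)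
  have profile: "s * (r * (n \<bullet> q)) \<le> r\<^sup>2 - (norm (x - s *\<^sub>R q - y))\<^sup>2" if "s \<in> {0..\<delta>}" for s
  proof -
    have "x - s *\<^sub>R q - y = r *\<^sub>R n - s *\<^sub>R q" using n(1) by (simp add: algebra_simps)
    then have "(norm (x - s *\<^sub>R q - y))\<^sup>2 = r\<^sup>2 - 2 * s * (r * (n \<bullet> q)) + s * (s * (q \<bullet> q))"
      by (simp only: power2_norm_eq_inner)
         (simp add: inner_diff_left inner_diff_right nn inner_commute[of q n] power2_eq_square algebra_simps)
    moreover have "s * (q \<bullet> q) \<le> r * (n \<bullet> q)"
      using that q by (simp add: \<delta>_def pos_le_divide_eq)
    then have "s * (s * (q \<bullet> q)) \<le> s * (r * (n \<bullet> q))" using that by (intro mult_left_mono) auto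
    ultimately show ?thesis by (simp add: algebra_simps)
  qed
  have inball: "x - s *\<^sub>R q \<in> cball y r" if "s \<in> {0..\<delta>}" for s
  proof -
    have "0 \<le> s * (r * (n \<bullet> q))" using that r n(3) by simp
    then have "(norm (x - s *\<^sub>R q - y))\<^sup>2 \<le> r\<^sup>2" using profile[OF that] by linarith
    then have "norm (x - s *\<^sub>R q - y) \<le> r" using power2_le_imp_le r by fastforce
    then show ?thesis by (simp add: dist_norm norm_minus_commute)
  qed
  have "((\<lambda>s. x - s *\<^sub>R q) has_derivative (\<lambda>h. - (h *\<^sub>R q))) (at 0 within {0..\<delta>})"
    by (auto intro!: derivative_eq_intros)
  moreover have "(w has_derivative (\<lambda>h. G \<bullet> h)) (at (x - 0 *\<^sub>R q) within (\<lambda>s. x - s *\<^sub>R q) ` {0..\<delta>})"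
    using has_derivative_subset[OF D] inball K by (simp add: image_subset_iff subsetD)
  ultimately have "((\<lambda>s. w (x - s *\<^sub>R q)) has_derivative (\<lambda>h. G \<bullet> (- (h *\<^sub>R q)))) (at 0 within {0..\<delta>})"
    by (rule has_derivative_in_compose)
  moreover have "(\<lambda>h. G \<bullet> (- (h *\<^sub>R q))) = (*) (- (G \<bullet> q))" by auto
  ultimately have "((\<lambda>s. w (x - s *\<^sub>R q)) has_real_derivative - (G \<bullet> q)) (at 0 within {0..\<delta>})"
    by (simp add: has_field_derivative_def)
  then have lim: "((\<lambda>s. w (x - s *\<^sub>R q) / s) \<longlongrightarrow> - (G \<bullet> q)) (at_right 0)"
    by (simp add: has_field_derivative_iff x at_within_Icc_at_right[OF \<delta>])
  have "\<forall>\<^sub>F s in at_right 0. \<epsilon> * (r * (n \<bullet> q)) \<le> w (x - s *\<^sub>R q) / s"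
  proof (rule eventually_at_rightI[OF _ \<delta>])
    fix s assume s: "s \<in> {0<..<\<delta>}"
    then have "\<epsilon> * (s * (r * (n \<bullet> q))) \<le> \<epsilon> * (r\<^sup>2 - (norm (x - s *\<^sub>R q - y))\<^sup>2)"
      using profile[of s] \<epsilon>(1) by (intro mult_left_mono) auto
    also have "\<dots> \<le> w (x - s *\<^sub>R q)" using s by (intro \<epsilon>(2) inball) auto
    finally show "\<epsilon> * (r * (n \<bullet> q)) \<le> w (x - s *\<^sub>R q) / s"
      using s by (simp add: pos_le_divide_eq mult_ac)
  qed
  then have "\<epsilon> * (r * (n \<bullet> q)) \<le> - (G \<bullet> q)"
    by (intro tendsto_lowerbound[OF lim]) auto
  moreover have "0 < \<epsilon> * (r * (n \<bullet> q))" using \<epsilon>(1) r n(3) by simp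
  ultimately show ?thesis by linarith
qed

section \<open>Interior spheres and the normal\<close>

text \<open>The boundary point nearest to an interior point close to \<open>S\<close> has an interior sphere.\<close>

lemma interior_sphere_point:
  fixes \<Omega> S :: "'a::euclidean_space set"
  assumes "open \<Omega>" and S: "openin (top_of_set (frontier \<Omega>)) S" "S \<noteq> {}"
  obtains x y r where "x \<in> S" "0 < r" "ball y r \<subseteq> \<Omega>" "dist y x = r"
proof -
  obtain p where p: "p \<in> S" using S by blast
  then obtain e where e: "e > 0" "ball p e \<inter> frontier \<Omega> \<subseteq> S"
    using S(1) by (auto simp: openin_contains_ball)
  have pf: "p \<in> frontier \<Omega>" using p S(1) openin_imp_subset by blast
  then have "p \<in> closure \<Omega>" by (simp add: frontier_def)
  \<comment> \<open>Half of \<open>e\<close>, because the boundary point nearest to \<open>y\<close>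
    is no farther from \<open>y\<close> than \<open>p\<close> and so lies within \<open>e\<close> of
    \<open>p\<close>.\<close>
  then obtain y where y: "y \<in> \<Omega>" "dist y p < e / 2"
    using e(1) by (meson closure_approachable half_gt_zero)
  obtain x where x: "x \<in> frontier \<Omega>" "\<And>z. z \<in> frontier \<Omega> \<Longrightarrow> dist y x \<le> dist y z"
    using distance_attains_inf[of "frontier \<Omega>" y] pf frontier_closed by blast
  have "dist p x \<le> dist p y + dist y x" by (rule dist_triangle)
  also have "\<dots> < e" using y(2) x(2)[OF pf] by (simp add: dist_commute)
  finally have "x \<in> S" using e(2) x(1) by auto
  moreover have "y \<noteq> x" using y(1) x(1) \<open>open \<Omega>\<close> by (auto simp: frontier_def interior_open)
  moreover have "ball y (dist y x) \<subseteq> \<Omega>"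
  proof (rule ccontr)
    assume "\<not> ball y (dist y x) \<subseteq> \<Omega>"
    moreover have "y \<in> ball y (dist y x)" using \<open>y \<noteq> x\<close> by simp
    ultimately have "ball y (dist y x) \<inter> frontier \<Omega> \<noteq> {}"
      using y(1) by (intro connected_Int_frontier connected_ball) blast+
    then show False using x(2) by fastforce
  qed
  ultimately show thesis using that[of x "dist y x" y] by simp
qed

text \<open>A boundary curve cannot enter the ball, so its squared distance to \<open>y\<close> is
  minimal at parameter 0.\<close>

lemma boundary_tangent_orthogonal:
  assumes "open \<Omega>" and ball: "ball y r \<subseteq> \<Omega>" "dist y x = r"
    and "boundary_tangent \<Omega> x v"
  shows "(x - y) \<bullet> v = 0"
proof -
  obtain \<gamma> where \<gamma>: "\<gamma> 0 = x" "\<forall>\<^sub>F s in nhds 0. \<gamma> s \<in> frontier \<Omega>"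
      "(\<gamma> has_vector_derivative v) (at (0::real))"
    using assms(4) by (auto simp: boundary_tangent_def)
  obtain d where d: "d > 0" "\<And>s. \<bar>s\<bar> < d \<Longrightarrow> \<gamma> s \<in> frontier \<Omega>"
    using \<gamma>(2) by (auto simp: eventually_nhds_metric)
  define f where "f = (\<lambda>s. (\<gamma> s - y) \<bullet> (\<gamma> s - y))"
  have "(f has_derivative (\<lambda>h. (\<gamma> 0 - y) \<bullet> (h *\<^sub>R v) + (h *\<^sub>R v) \<bullet> (\<gamma> 0 - y))) (at 0)"
    unfolding f_def using \<gamma>(3)
    by (auto intro!: derivative_eq_intros simp: has_vector_derivative_def)
  moreover have "(\<lambda>h. (\<gamma> 0 - y) \<bullet> (h *\<^sub>R v) + (h *\<^sub>R v) \<bullet> (\<gamma> 0 - y)) = (*) (2 * ((x - y) \<bullet> v))"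
    by (auto simp: \<gamma>(1) inner_commute)
  ultimately have "(f has_real_derivative 2 * ((x - y) \<bullet> v)) (at 0)"
    by (simp add: has_field_derivative_def)
  moreover have "f 0 \<le> f s" if "\<bar>0 - s\<bar> < d" for s
  proof -
    have "\<gamma> s \<notin> \<Omega>" using d(2)[of s] that \<open>open \<Omega>\<close> by (auto simp: frontier_def interior_open)
    then have "\<gamma> s \<notin> ball y r" using ball(1) by blast
    then have "norm (x - y) \<le> norm (\<gamma> s - y)"
      using ball(2) by (simp add: dist_norm norm_minus_commute)
    then have "(norm (x - y))\<^sup>2 \<le> (norm (\<gamma> s - y))\<^sup>2" by (intro power_mono) auto
    then show ?thesis by (simp add: f_def \<gamma>(1) dot_square_norm)
  qed
  ultimately have "2 * ((x - y) \<bullet> v) = 0" using d(1) by (intro DERIV_local_min) auto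
  then show ?thesis by simp
qed

lemma holder_on_differentiable:
  assumes "holder_on (Suc k) \<beta> U f" "open U" "x \<in> U"
  shows "f differentiable (at x)"
proof -
  have "f differentiable_on U" using assms(1) by (simp add: holder_on_def)
  then show ?thesis using assms(2,3) by (simp add: differentiable_on_eq_differentiable_at)
qed

text \<open>
  In a boundary chart the boundary curves through \<open>x\<close> are images of lines in the hyperplane, so
  their velocities span the image of that hyperplane, which has codimension one.
\<close>

lemma normal_space_one_dimensional:
  fixes \<Omega> :: "(real^'n) set"
  assumes bd: "holder_boundary 2 \<alpha> \<Omega>" and x: "x \<in> frontier \<Omega>"
    and n: "n \<noteq> 0" "\<And>v. boundary_tangent \<Omega> x v \<Longrightarrow> n \<bullet> v = 0"
    and p: "\<And>v. boundary_tangent \<Omega> x v \<Longrightarrow> p \<bullet> v = 0"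
  shows "\<exists>l. p = l *\<^sub>R n"
proof -
  from bspec[OF bd[unfolded holder_boundary_def] x] obtain U V and \<psi> \<psi>' :: "real^'n \<Rightarrow> real^'n" and m where ch: "open U" "x \<in> U" "open V" "homeomorphism U V \<psi> \<psi>'"
      "holder_on 2 \<alpha> U \<psi>" "holder_on 2 \<alpha> V \<psi>'"
      "\<psi> ` (U \<inter> frontier \<Omega>) = V \<inter> {y. y $ m = (0::real)}"
    by blast
  have \<psi>: "\<psi> x \<in> V" "\<psi> x $ m = 0" using ch(2,7) x by auto
  obtain D where D: "(\<psi> has_derivative D) (at x)"
    using holder_on_differentiable[OF ch(5)[unfolded numeral_2_eq_2] ch(1,2)]
    unfolding differentiable_def by blast
  obtain D' where D': "(\<psi>' has_derivative D') (at (\<psi> x))"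
    using holder_on_differentiable[OF ch(6)[unfolded numeral_2_eq_2] ch(3) \<psi>(1)]
    unfolding differentiable_def by blast
  have "((\<lambda>z. \<psi>' (\<psi> z)) has_derivative (\<lambda>h. D' (D h))) (at x)"
    using has_derivative_compose[OF D D'] .
  then have "((\<lambda>z. z) has_derivative (\<lambda>h. D' (D h))) (at x)"
    by (rule has_derivative_transform_within_open[OF _ ch(1,2)])
       (use ch(4) in \<open>simp add: homeomorphism_def\<close>)
  then have "(\<lambda>h. D' (D h)) = (\<lambda>h. h)"
    using has_derivative_unique has_derivative_ident by blast
  then have inv: "D' (D h) = h" for h by metis
  interpret D': bounded_linear D' using D' by (rule has_derivative_bounded_linear)
  have tangent: "boundary_tangent \<Omega> x (D' e)" if e: "e $ m = 0" for e
  proof -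
    define \<gamma> where "\<gamma> = (\<lambda>s. \<psi>' (\<psi> x + s *\<^sub>R e))"
    have lim: "filterlim (\<lambda>s. \<psi> x + s *\<^sub>R e) (nhds (\<psi> x)) (nhds 0)"
      by (rule tendsto_eq_rhs[OF tendsto_add[OF tendsto_const tendsto_scaleR[OF filterlim_ident tendsto_const]]])
         simp
    have "\<forall>\<^sub>F s in nhds 0. \<psi> x + s *\<^sub>R e \<in> V"
      using eventually_compose_filterlim[OF eventually_nhds_in_open[OF ch(3) \<psi>(1)] lim] .
    then have "\<forall>\<^sub>F s in nhds 0. \<gamma> s \<in> frontier \<Omega>"
    proof eventually_elim
      case (elim s)
      then have "\<psi> x + s *\<^sub>R e \<in> \<psi> ` (U \<inter> frontier \<Omega>)" using \<psi>(2) e ch(7) by simp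
      then show ?case using ch(4) by (auto simp: \<gamma>_def homeomorphism_def)
    qed
    moreover have "\<gamma> 0 = x" using ch(2,4) by (simp add: \<gamma>_def homeomorphism_def)
    moreover have "(\<gamma> has_vector_derivative D' e) (at 0)"
    proof -
      have "((\<lambda>s. \<psi> x + s *\<^sub>R e) has_derivative (\<lambda>h. h *\<^sub>R e)) (at 0)"
        by (auto intro!: derivative_eq_intros)
      moreover have "(\<psi>' has_derivative D') (at (\<psi> x + 0 *\<^sub>R e))" using D' by simp
      ultimately have "(\<gamma> has_derivative (\<lambda>h. D' (h *\<^sub>R e))) (at 0)"
        unfolding \<gamma>_def by (rule has_derivative_compose)
      then show ?thesis by (simp add: has_vector_derivative_def D'.scaleR)
    qed
    ultimately show ?thesis unfolding boundary_tangent_def by blast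
  qed
  define k where "k = D' (axis m 1)"
  \<comment> \<open>Up to a multiple of \<open>k\<close>, every vector is the image of one in the
    hyperplane, hence tangent. A vector orthogonal to the tangents is thus determined by its product
    with \<open>k\<close>.\<close>
  have decomp: "q \<bullet> h = D h $ m * (q \<bullet> k)"
    if q: "\<And>v. boundary_tangent \<Omega> x v \<Longrightarrow> q \<bullet> v = 0" for q h
  proof -
    define e where "e = D h - (D h $ m) *\<^sub>R axis m 1"
    have "e $ m = 0" by (simp add: e_def)
    then have "q \<bullet> D' e = 0" using q tangent by blast
    moreover have "h = D' e + (D h $ m) *\<^sub>R k"
      by (simp add: e_def k_def D'.diff D'.scaleR inv)
    ultimately show ?thesis by (metis inner_add_right inner_scaleR_right add_0)
  qed
  have "n \<bullet> n = D n $ m * (n \<bullet> k)" using n(2) by (rule decomp)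
  then have nk: "n \<bullet> k \<noteq> 0" using n(1) by force
  have "p \<bullet> h = ((p \<bullet> k) / (n \<bullet> k)) *\<^sub>R n \<bullet> h" for h
    using decomp[OF p, of h] decomp[OF n(2), of h] nk by simp
  then show ?thesis by (meson vector_eq_rdot)
qed

text \<open>Both \<open>x - y\<close> and \<open>n\<close> are orthogonal to all tangents, hence
  parallel. If they were opposite, the points \<open>x + s *\<^sub>R n\<close> would run into the
  ball towards \<open>y\<close>, although they lie outside the closure.\<close>

lemma outward_normal_interior_sphere:
  fixes \<Omega> :: "(real^'n) set"
  assumes "open \<Omega>" "holder_boundary 2 \<alpha> \<Omega>" "x \<in> frontier \<Omega>"
    and n: "is_unit_outward_normal \<Omega> x n"
    and r: "0 < r" and ball: "ball y r \<subseteq> \<Omega>" "dist y x = r"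
  shows "x - y = r *\<^sub>R n"
proof -
  have n1: "norm n = 1" "\<And>v. boundary_tangent \<Omega> x v \<Longrightarrow> n \<bullet> v = 0"
      "\<forall>\<^sub>F s in at_right (0::real). x + s *\<^sub>R n \<notin> closure \<Omega>"
    using n by (auto simp: is_unit_outward_normal_def elim: eventually_mono)
  have "n \<noteq> 0" using n1(1) by auto
  obtain l where l: "x - y = l *\<^sub>R n"
    using normal_space_one_dimensional[OF assms(2,3) \<open>n \<noteq> 0\<close> n1(2)
        boundary_tangent_orthogonal[OF assms(1) ball]] by blast
  have "\<bar>l\<bar> = r"
    using ball(2) n1(1) arg_cong[OF l, of norm] by (simp add: dist_norm norm_minus_commute)
  moreover have "l \<noteq> - r"
  proof
    assume "l = - r"
    have "\<forall>\<^sub>F s in at_right (0::real). 0 < s \<and> s < r"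
      using r by (intro eventually_at_rightI[of 0 r]) auto
    with n1(3) have "\<forall>\<^sub>F s in at_right (0::real). False"
    proof eventually_elim
      case (elim s)
      have "x + s *\<^sub>R n - y = (s - r) *\<^sub>R n"
        using l \<open>l = - r\<close> by (simp add: algebra_simps)
      then have "dist y (x + s *\<^sub>R n) = \<bar>s - r\<bar>"
        using n1(1) by (metis dist_commute dist_norm mult.right_neutral norm_scaleR)
      then have "x + s *\<^sub>R n \<in> \<Omega>" using elim ball(1) by (auto simp: subset_iff)
      then show False using elim closure_subset by blast
    qed
    then show False by (simp add: eventually_False)
  qed
  ultimately have "l = r" using r by linarith
  then show ?thesis using l by simp
qed

section \<open>The equation in nondivergence form\<close>

lemma at_within_closure_open:
  assumes "open \<Omega>" "x \<in> \<Omega>" shows "at x within closure \<Omega> = at x"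
  using assms interior_maximal[OF closure_subset \<open>open \<Omega>\<close>] by (intro at_within_interior) auto

lemma space_partial_eq:
  assumes "open \<Omega>" "x \<in> \<Omega>" "((\<lambda>y. f y t) has_derivative D) (at x)"
  shows "space_partial \<Omega> i f x t = D (axis i 1)"
  using frechet_derivative_at[OF assms(3)] at_within_closure_open[OF assms(1,2)]
  by (simp add: space_partial_def partial_in_def)

text \<open>Formulated relative to the closure because Hopf's lemma differentiates at a boundary
  point.\<close>

lemma has_derivative_space_grad:
  fixes u :: "real^'n \<Rightarrow> real \<Rightarrow> real"
  assumes "(\<lambda>y. u y t) differentiable (at x within closure \<Omega>)"
  shows "((\<lambda>y. u y t) has_derivative (\<lambda>h. space_grad \<Omega> u x t \<bullet> h)) (at x within closure \<Omega>)"
proof -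
  define D where "D = frechet_derivative (\<lambda>y. u y t) (at x within closure \<Omega>)"
  have D: "((\<lambda>y. u y t) has_derivative D) (at x within closure \<Omega>)"
    using assms by (simp add: D_def frechet_derivative_works)
  interpret linear D using D by (rule has_derivative_linear)
  have "D h = space_grad \<Omega> u x t \<bullet> h" for h
  proof -
    have "D h = D (\<Sum>i\<in>UNIV. h $ i *\<^sub>R axis i 1)"
      by (simp add: basis_expansion flip: scalar_mult_eq_scaleR)
    also have "\<dots> = (\<Sum>i\<in>UNIV. h $ i * D (axis i 1))" by (simp add: sum scale)
    finally show ?thesis
      by (simp add: inner_vec_def space_grad_def space_partial_def partial_in_def D_def mult.commute)
  qed
  then show ?thesis using D by (metis (no_types, lifting) ext)
qed

lemma has_derivative_vec_componentwise:
  fixes f :: "'a::real_normed_vector \<Rightarrow> real^'n"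
  assumes "\<And>i. ((\<lambda>x. f x $ i) has_derivative (\<lambda>h. f' h $ i)) (at x within S)"
  shows "(f has_derivative f') (at x within S)"
  unfolding has_derivative_componentwise_within[of f f'] Basis_vec_def
  using assms by (auto simp: inner_axis)

lemma parabolic_holder_imp:
  assumes "parabolic_holder \<alpha> \<Omega> T u"
  shows "\<And>t. t \<in> {0..T} \<Longrightarrow> (\<lambda>y. u y t) differentiable_on closure \<Omega>"
    and "\<And>t i. t \<in> {0..T} \<Longrightarrow> (\<lambda>y. space_partial \<Omega> i u y t) differentiable_on closure \<Omega>"
    and "\<And>x. x \<in> closure \<Omega> \<Longrightarrow> u x differentiable_on {0..T}"
proof -
  have 1: "(\<lambda>y. u y t) differentiable_on closure \<Omega> \<and>
      (\<forall>i\<in>Basis. partial_in (closure \<Omega>) i (\<lambda>y. u y t) differentiable_on closure \<Omega>)"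
    if "t \<in> {0..T}" for t
    using assms that by (auto simp: parabolic_holder_def numeral_2_eq_2)
  show "(\<lambda>y. u y t) differentiable_on closure \<Omega>" if "t \<in> {0..T}" for t
    using 1[OF that] by blast
  show "(\<lambda>y. space_partial \<Omega> i u y t) differentiable_on closure \<Omega>" if "t \<in> {0..T}" for t i
    using 1[OF that] by (simp add: space_partial_def Basis_vec_def)
  show "u x differentiable_on {0..T}" if "x \<in> closure \<Omega>" for x
    using assms that by (auto simp: parabolic_holder_def)
qed

lemma parabolic_holder_jet:
  fixes u :: "real^'n \<Rightarrow> real \<Rightarrow> real"
  assumes u: "parabolic_holder \<alpha> \<Omega> T u" and \<Omega>: "open \<Omega>" "x \<in> \<Omega>" and t: "t \<in> {0<..<T}"
  shows "parabolic_jet u x t (time_deriv T u x t) (space_grad \<Omega> u x t)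
    (\<chi> i j. space_partial \<Omega> j (space_partial \<Omega> i u) x t)"
proof -
  have t': "t \<in> {0..T}" using t by auto
  have "u x differentiable (at t within {0..T})"
    using parabolic_holder_imp(3)[OF u subsetD[OF closure_subset \<Omega>(2)]] t'
    by (auto simp: differentiable_on_def)
  then have "(u x has_vector_derivative time_deriv T u x t) (at t within {0..T})"
    by (simp add: time_deriv_def vector_derivative_works)
  moreover have "at t within {0..T} = at t" using t by (intro at_within_interior) simp
  ultimately have time: "(u x has_real_derivative time_deriv T u x t) (at t)"
    by (simp add: has_real_derivative_iff_has_vector_derivative)
  have grad: "((\<lambda>y. v y t) has_derivative (\<lambda>h. space_grad \<Omega> v y t \<bullet> h)) (at y)"
    if "(\<lambda>y. v y t) differentiable_on closure \<Omega>" "y \<in> \<Omega>" for y and v :: "real^'n \<Rightarrow> real \<Rightarrow> real"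
    using has_derivative_space_grad[of v t y \<Omega>] that(1) subsetD[OF closure_subset that(2)]
      at_within_closure_open[OF \<Omega>(1) that(2)] by (auto simp: differentiable_on_def)
  show ?thesis unfolding parabolic_jet_def
  proof (intro conjI exI[of _ "\<lambda>y. space_grad \<Omega> u y t"] refl time)
    have "\<forall>\<^sub>F y in nhds x. y \<in> \<Omega>" using \<Omega> by (rule eventually_nhds_in_open)
    then show "\<forall>\<^sub>F y in nhds x. ((\<lambda>y. u y t) has_derivative (\<bullet>) (space_grad \<Omega> u y t)) (at y)"
      by eventually_elim (rule grad[where v = u, OF parabolic_holder_imp(1)[OF u t']])
    show "((\<lambda>y. space_grad \<Omega> u y t) has_derivative
        (*v) (\<chi> i j. space_partial \<Omega> j (space_partial \<Omega> i u) x t)) (at x)"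
    proof (rule has_derivative_vec_componentwise)
      fix i
      have "((\<lambda>y. space_partial \<Omega> i u y t) has_derivative
          (\<lambda>h. space_grad \<Omega> (space_partial \<Omega> i u) x t \<bullet> h)) (at x)"
          by (rule grad[where v = "space_partial \<Omega> i u", OF parabolic_holder_imp(2)[OF u t'] \<Omega>(2)])
      then show "((\<lambda>y. space_grad \<Omega> u y t $ i) has_derivative
          (\<lambda>h. ((\<chi> i j. space_partial \<Omega> j (space_partial \<Omega> i u) x t) *v h) $ i)) (at x)"
        by (simp add: space_grad_def inner_vec_def matrix_vector_mult_def)
    qed
  qed
qed

text \<open>The product rule splits off a first-order part made of the divergences of the columns of
  \<open>A\<close>.\<close>

lemma space_div_matrix_grad:
  fixes u :: "real^'n \<Rightarrow> real \<Rightarrow> real"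
  assumes u: "parabolic_holder \<alpha> \<Omega> T u" and \<Omega>: "open \<Omega>" "x \<in> \<Omega>" and t: "t \<in> {0<..<T}"
    and A: "\<And>i j. (\<lambda>y. A y t $ i $ j) differentiable (at x)"
    and sym: "\<And>i j. A x t $ i $ j = A x t $ j $ i"
  shows "space_div \<Omega> (\<lambda>y s. A y s *v space_grad \<Omega> u y s) x t =
    A x t \<bullet> (\<chi> i j. space_partial \<Omega> j (space_partial \<Omega> i u) x t)
    + (\<chi> j. \<Sum>i\<in>UNIV. space_partial \<Omega> i (\<lambda>y s. A y s $ i $ j) x t) \<bullet> space_grad \<Omega> u x t"
proof -
  have t': "t \<in> {0..T}" using t by auto
  have dA: "((\<lambda>y. A y t $ i $ j) has_derivative (\<lambda>h. space_grad \<Omega> (\<lambda>y s. A y s $ i $ j) x t \<bullet> h)) (at x)" for i j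
    using has_derivative_space_grad[of "\<lambda>y s. A y s $ i $ j" t x \<Omega>] A[of i j]
    by (simp add: at_within_closure_open[OF \<Omega>])
  have dU: "((\<lambda>y. space_partial \<Omega> j u y t) has_derivative
      (\<lambda>h. space_grad \<Omega> (space_partial \<Omega> j u) x t \<bullet> h)) (at x)" for j
    using has_derivative_space_grad[of "space_partial \<Omega> j u" t x \<Omega>]
      parabolic_holder_imp(2)[OF u t', of j] subsetD[OF closure_subset \<Omega>(2)]
    by (auto simp: at_within_closure_open[OF \<Omega>] differentiable_on_def)
  have "space_partial \<Omega> i (\<lambda>y s. (A y s *v space_grad \<Omega> u y s) $ i) x t =
      (\<Sum>j\<in>UNIV. A x t $ i $ j * space_partial \<Omega> i (space_partial \<Omega> j u) x t
        + space_partial \<Omega> i (\<lambda>y s. A y s $ i $ j) x t * space_partial \<Omega> j u x t)" for i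
  proof -
    have "((\<lambda>y. \<Sum>j\<in>UNIV. A y t $ i $ j * space_partial \<Omega> j u y t) has_derivative
      (\<lambda>h. \<Sum>j\<in>UNIV. A x t $ i $ j * (space_grad \<Omega> (space_partial \<Omega> j u) x t \<bullet> h)
        + space_grad \<Omega> (\<lambda>y s. A y s $ i $ j) x t \<bullet> h * space_partial \<Omega> j u x t)) (at x)"
      by (intro has_derivative_sum has_derivative_mult dA dU)
    then have "((\<lambda>y. (A y t *v space_grad \<Omega> u y t) $ i) has_derivative
      (\<lambda>h. \<Sum>j\<in>UNIV. A x t $ i $ j * (space_grad \<Omega> (space_partial \<Omega> j u) x t \<bullet> h)
        + space_grad \<Omega> (\<lambda>y s. A y s $ i $ j) x t \<bullet> h * space_partial \<Omega> j u x t)) (at x)"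
      by (simp add: matrix_vector_mult_def space_grad_def)
    from space_partial_eq[OF \<Omega>, of "\<lambda>y s. (A y s *v space_grad \<Omega> u y s) $ i", OF this] show ?thesis
      by (simp add: inner_axis space_grad_def)
  qed
  then have "space_div \<Omega> (\<lambda>y s. A y s *v space_grad \<Omega> u y s) x t =
      (\<Sum>i\<in>UNIV. \<Sum>j\<in>UNIV. A x t $ i $ j * space_partial \<Omega> i (space_partial \<Omega> j u) x t)
      + (\<Sum>i\<in>UNIV. \<Sum>j\<in>UNIV. space_partial \<Omega> i (\<lambda>y s. A y s $ i $ j) x t * space_partial \<Omega> j u x t)"
    by (simp add: space_div_def sum.distrib)
  \<comment> \<open>Symmetry of \<open>A\<close> brings the mixed derivatives into the index order
    of the Hessian in the jet.\<close>
  also have "(\<Sum>i\<in>UNIV. \<Sum>j\<in>UNIV. A x t $ i $ j * space_partial \<Omega> i (space_partial \<Omega> j u) x t)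
      = (\<Sum>i\<in>UNIV. \<Sum>j\<in>UNIV. A x t $ i $ j * space_partial \<Omega> j (space_partial \<Omega> i u) x t)"
    by (subst sum.swap) (simp add: sym)
  also have "(\<Sum>i\<in>UNIV. \<Sum>j\<in>UNIV. space_partial \<Omega> i (\<lambda>y s. A y s $ i $ j) x t * space_partial \<Omega> j u x t)
      = (\<chi> j. \<Sum>i\<in>UNIV. space_partial \<Omega> i (\<lambda>y s. A y s $ i $ j) x t) \<bullet> space_grad \<Omega> u x t"
    by (subst sum.swap) (simp add: inner_vec_def space_grad_def sum_distrib_right)
  finally show ?thesis by (simp add: inner_vec_def)
qed

section \<open>Joint continuity of solutions and bounds for the coefficients\<close>

lemma parabolic_holder_time_lipschitz:
  assumes u: "parabolic_holder \<alpha> \<Omega> T u"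
  obtains M where "0 \<le> M" "\<And>x s t. x \<in> closure \<Omega> \<Longrightarrow> s \<in> {0..T} \<Longrightarrow> t \<in> {0..T} \<Longrightarrow>
    \<bar>u x s - u x t\<bar> \<le> M * \<bar>s - t\<bar>"
proof -
  let ?N = "cyl_sup \<Omega> T (time_deriv T u)"
  have "?N \<le> parabolic_holder_norm \<alpha> \<Omega> T u"
    unfolding parabolic_holder_norm_def Let_def by (simp add: add_increasing add.assoc)
  then have fin: "?N < top" using u by (auto simp: parabolic_holder_def)
  define M where "M = enn2real ?N"
  have bound: "norm (time_deriv T u x t) \<le> M" if "x \<in> closure \<Omega>" "t \<in> {0..T}" for x t
  proof -
    have "ennreal (norm (time_deriv T u x t)) \<le> sup_norm_on (closure \<Omega>) (\<lambda>x. time_deriv T u x t)"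
      unfolding sup_norm_on_def using that by (intro SUP_upper)
    also have "\<dots> \<le> ?N" unfolding cyl_sup_def using that by (intro SUP_upper)
    finally show ?thesis
      unfolding M_def using fin by (metis enn2real_ennreal enn2real_mono norm_ge_zero)
  qed
  show thesis
  proof (rule that[of M])
    show "0 \<le> M" by (simp add: M_def)
    fix x s t assume *: "x \<in> closure \<Omega>" "s \<in> {0..T}" "t \<in> {0..T}"
    have "norm (u x s - u x t) \<le> M * norm (s - t)"
    proof (rule field_differentiable_bound[of "{0..T}" "u x" "time_deriv T u x"])
      fix z assume z: "z \<in> {0..T}"
      then have "u x differentiable (at z within {0..T})"
        using parabolic_holder_imp(3)[OF u *(1)] by (auto simp: differentiable_on_def)
      then show "(u x has_field_derivative time_deriv T u x z) (at z within {0..T})"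
        by (simp add: time_deriv_def vector_derivative_works has_real_derivative_iff_has_vector_derivative)
    qed (use * bound in auto)
    then show "\<bar>u x s - u x t\<bar> \<le> M * \<bar>s - t\<bar>" by simp
  qed
qed

text \<open>Regularity is given slice by slice, but the Lipschitz constant in time is uniform in
  \<open>x\<close>; together with continuity in \<open>x\<close> at one fixed time this gives joint
  continuity.\<close>

lemma parabolic_holder_continuous:
  assumes u: "parabolic_holder \<alpha> \<Omega> T u"
  shows "continuous_on (closure \<Omega> \<times> {0..T}) (\<lambda>z. u (fst z) (snd z))"
  unfolding continuous_on_iff
proof (intro ballI allI impI)
  obtain M where M: "0 \<le> M" "\<And>x s t. x \<in> closure \<Omega> \<Longrightarrow> s \<in> {0..T} \<Longrightarrow> t \<in> {0..T} \<Longrightarrow>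
    \<bar>u x s - u x t\<bar> \<le> M * \<bar>s - t\<bar>" using parabolic_holder_time_lipschitz[OF u] by blast
  fix z and e :: real assume z: "z \<in> closure \<Omega> \<times> {0..T}" and e: "0 < e"
  obtain x t where xt: "z = (x, t)" "x \<in> closure \<Omega>" "t \<in> {0..T}" using z by auto
  have "continuous_on (closure \<Omega>) (\<lambda>y. u y t)"
    using parabolic_holder_imp(1)[OF u xt(3)] by (rule differentiable_imp_continuous_on)
  then obtain d where d: "d > 0" "\<And>y. y \<in> closure \<Omega> \<Longrightarrow> dist y x < d \<Longrightarrow> dist (u y t) (u x t) < e / 2"
    using xt(2) e unfolding continuous_on_iff by (meson half_gt_zero)
  \<comment> \<open>\<open>M + 1\<close> keeps \<open>\<delta>\<close> positive for
    \<open>M = 0\<close>, where division by zero would return 0.\<close>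
  define \<delta> where "\<delta> = min d (e / (2 * (M + 1)))"
  have \<delta>: "0 < \<delta>" using d e M by (simp add: \<delta>_def)
  show "\<exists>d>0. \<forall>z'\<in>closure \<Omega> \<times> {0..T}. dist z' z < d \<longrightarrow> dist (u (fst z') (snd z')) (u (fst z) (snd z)) < e"
  proof (intro exI[of _ \<delta>] conjI ballI impI \<delta>)
    fix z' assume z': "z' \<in> closure \<Omega> \<times> {0..T}" "dist z' z < \<delta>"
    obtain y s where ys: "z' = (y, s)" "y \<in> closure \<Omega>" "s \<in> {0..T}" using z' by auto
    have dy: "dist y x < \<delta>" using dist_fst_le[of z' z] z'(2) by (simp add: ys xt)
    have ds: "\<bar>s - t\<bar> < \<delta>" using dist_snd_le[of z' z] z'(2) by (simp add: ys xt dist_real_def)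
    have "\<bar>u y s - u y t\<bar> \<le> M * \<bar>s - t\<bar>" using M(2) ys xt by auto
    also have "\<dots> \<le> (M + 1) * (e / (2 * (M + 1)))"
      using ds M e by (intro mult_mono) (auto simp: \<delta>_def)
    also have "\<dots> = e / 2" using M by (simp add: field_simps)
    finally have "\<bar>u y s - u y t\<bar> \<le> e / 2" .
    moreover have "\<bar>u y t - u x t\<bar> < e / 2" using d(2)[OF ys(2)] dy by (simp add: \<delta>_def dist_real_def)
    ultimately show "dist (u (fst z') (snd z')) (u (fst z) (snd z)) < e"
      unfolding ys xt dist_real_def fst_conv snd_conv by linarith
  qed
qed

lemma holder_on_one_imp:
  assumes "holder_on 1 \<alpha> S f"
  shows "f differentiable_on S" "\<And>i. i \<in> Basis \<Longrightarrow> continuous_on S (partial_in S i f)"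
  using assms by (auto simp: holder_on_def)

text \<open>The coefficients are regular jointly on the closed cylinder, whereas
  \<open>space_partial\<close> differentiates a slice. At interior points both are ordinary
  derivatives, and the chain rule identifies them.\<close>

lemma holder_on_one_slice:
  fixes f :: "real^'n \<Rightarrow> real \<Rightarrow> real"
  assumes f: "holder_on 1 \<alpha> (closure \<Omega> \<times> {0..T}) (\<lambda>(x, t). f x t)"
    and \<Omega>: "open \<Omega>" "x \<in> \<Omega>" and t: "t \<in> {0<..<T}"
  shows "(\<lambda>y. f y t) differentiable (at x)"
    and "space_partial \<Omega> i f x t = partial_in (closure \<Omega> \<times> {0..T}) (axis i 1, 0) (\<lambda>(x, t). f x t) (x, t)"
proof -
  let ?S = "closure \<Omega> \<times> {0..T}"
  define D where "D = frechet_derivative (\<lambda>(x, t). f x t) (at (x, t) within ?S)"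
  have "(x, t) \<in> ?S" using \<Omega>(2) t closure_subset by auto
  then have D: "((\<lambda>(x, t). f x t) has_derivative D) (at (x, t) within ?S)"
    using holder_on_one_imp(1)[OF f] unfolding D_def differentiable_on_def frechet_derivative_works by blast
  have "\<Omega> \<times> {0<..<T} \<subseteq> ?S" using closure_subset by fastforce
  then have "(x, t) \<in> interior ?S"
    using \<Omega> t by (auto simp: interior_def intro!: exI[of _ "\<Omega> \<times> {0<..<T}"] open_Times)
  then have "at (x, t) within ?S = at (x, t)" by (rule at_within_interior)
  then have D: "((\<lambda>(x, t). f x t) has_derivative D) (at (x, t))" using D by simp
  have "((\<lambda>y. (y, t)) has_derivative (\<lambda>h. (h, 0))) (at x)"
    by (auto intro!: derivative_eq_intros)
  from has_derivative_compose[OF this D]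
  have D': "((\<lambda>y. f y t) has_derivative (\<lambda>h. D (h, 0))) (at x)" by simp
  then show "(\<lambda>y. f y t) differentiable (at x)" by (auto simp: differentiable_def)
  show "space_partial \<Omega> i f x t = partial_in ?S (axis i 1, 0) (\<lambda>(x, t). f x t) (x, t)"
    using space_partial_eq[where f = f, OF \<Omega> D'] by (simp add: partial_in_def D_def)
qed

lemma continuous_on_compact_norm_bound:
  fixes f :: "'a::topological_space \<Rightarrow> 'b::real_normed_vector"
  assumes "compact S" "continuous_on S f"
  obtains C where "\<And>x. x \<in> S \<Longrightarrow> norm (f x) \<le> C"
  using compact_imp_bounded[OF compact_continuous_image[OF assms(2,1)]] unfolding bounded_iff by blast

text \<open>Inside, the slicewise derivatives of \<open>A\<close> agree with joint ones, which are
  continuous on the compact closed cylinder.\<close>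

lemma coefficient_bounds:
  fixes A :: "real^'n \<Rightarrow> real \<Rightarrow> real^'n^'n" and B :: "real^'n \<Rightarrow> real \<Rightarrow> real^'n"
  assumes \<Omega>: "open \<Omega>" "bounded \<Omega>"
    and B: "holder_on 1 \<alpha> (closure \<Omega> \<times> {0..T}) (\<lambda>(x, t). B x t)"
    and A: "\<And>i j. holder_on 1 \<alpha> (closure \<Omega> \<times> {0..T}) (\<lambda>(x, t). A x t $ i $ j)"
  obtains C where "0 < C" "\<And>x t. x \<in> \<Omega> \<Longrightarrow> t \<in> {0<..<T} \<Longrightarrow> norm (A x t) \<le> C"
    "\<And>x t. x \<in> \<Omega> \<Longrightarrow> t \<in> {0<..<T} \<Longrightarrow>
      norm (B x t - (\<chi> j. \<Sum>i\<in>UNIV. space_partial \<Omega> i (\<lambda>y s. A y s $ i $ j) x t)) \<le> C"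
proof -
  let ?S = "closure \<Omega> \<times> {0..T}"
  have S: "compact ?S" using \<Omega> by (intro compact_Times) (auto simp: compact_closure)
  have sub: "(x, t) \<in> ?S" if "x \<in> \<Omega>" "t \<in> {0<..<T}" for x t
    using that closure_subset by auto
  have "continuous_on ?S (\<lambda>z. A (fst z) (snd z) $ i $ j)" for i j
    using differentiable_imp_continuous_on[OF holder_on_one_imp(1)[OF A[of i j]]]
    by (simp add: case_prod_unfold)
  then have "continuous_on ?S (\<lambda>z. \<chi> i j. A (fst z) (snd z) $ i $ j)"
    by (intro continuous_on_vec_lambda)
  then obtain C1 where C1: "\<And>z. z \<in> ?S \<Longrightarrow> norm (A (fst z) (snd z)) \<le> C1"
    using continuous_on_compact_norm_bound[OF S] by auto
  let ?P = "\<lambda>z. B (fst z) (snd z) -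
      (\<chi> j. \<Sum>i\<in>UNIV. partial_in ?S (axis i 1, 0) (\<lambda>(x, t). A x t $ i $ j) z)"
  have "continuous_on ?S (\<lambda>z. B (fst z) (snd z))"
    using differentiable_imp_continuous_on[OF holder_on_one_imp(1)[OF B]]
    by (simp add: case_prod_unfold)
  then have "continuous_on ?S ?P"
    by (intro continuous_intros continuous_on_vec_lambda holder_on_one_imp(2)[OF A])
       (auto simp: Basis_prod_def Basis_vec_def)
  then obtain C2 where C2: "\<And>z. z \<in> ?S \<Longrightarrow> norm (?P z) \<le> C2"
    using continuous_on_compact_norm_bound[OF S] by blast
  show thesis
  proof (rule that[of "max 1 (max C1 C2)"])
    fix x t assume xt: "x \<in> \<Omega>" "t \<in> {0<..<T}"
    show "norm (A x t) \<le> max 1 (max C1 C2)" using C1[OF sub[OF xt]] by simp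
    have "(\<chi> j. \<Sum>i\<in>UNIV. space_partial \<Omega> i (\<lambda>y s. A y s $ i $ j) x t) =
        (\<chi> j. \<Sum>i\<in>UNIV. partial_in ?S (axis i 1, 0) (\<lambda>(x, t). A x t $ i $ j) (x, t))"
      using holder_on_one_slice(2)[OF A \<Omega>(1) xt] by simp
    then show "norm (B x t - (\<chi> j. \<Sum>i\<in>UNIV. space_partial \<Omega> i (\<lambda>y s. A y s $ i $ j) x t)) \<le> max 1 (max C1 C2)"
      using C2[OF sub[OF xt]] by simp
  qed simp
qed

section \<open>Uniqueness of the nonlinearity\<close>

text \<open>Monotonicity gives the signs in comparisons, continuity carries identities to closures,
  and \<open>Q\<close> becomes the zero-order coefficient.\<close>

lemma C1_nondecreasing:
  fixes F :: "real \<Rightarrow> real"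
  assumes "F C1_differentiable_on UNIV" "\<forall>s. deriv F s \<ge> 0"
  shows "mono F" and "continuous_on UNIV F"
    and "\<exists>Q\<ge>0. \<forall>r\<in>{0..R}. \<forall>s\<in>{r..R}. F s - F r \<le> Q * (s - r)"
proof -
  obtain D where D: "\<And>x. (F has_real_derivative D x) (at x)" "continuous_on UNIV D"
    using assms(1) by (auto simp: C1_differentiable_on_def has_real_derivative_iff_has_vector_derivative)
  have D0: "0 \<le> D x" for x using assms(2) DERIV_imp_deriv[OF D(1)] by metis
  show "mono F" using DERIV_nonneg_imp_nondecreasing D(1) D0 by (metis monoI)
  show "continuous_on UNIV F" using D(1) by (meson DERIV_isCont continuous_at_imp_continuous_on)
  obtain Q where Q: "\<And>x. x \<in> {0..R} \<Longrightarrow> norm (D x) \<le> Q"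
    using continuous_on_compact_norm_bound[OF compact_Icc continuous_on_subset[OF D(2) subset_UNIV]]
    by blast
  show "\<exists>Q\<ge>0. \<forall>r\<in>{0..R}. \<forall>s\<in>{r..R}. F s - F r \<le> Q * (s - r)"
  proof (intro exI[of _ "\<bar>Q\<bar>"] conjI ballI)
    fix r s assume rs: "r \<in> {0..R}" "s \<in> {r..R}"
    have "norm (F s - F r) \<le> \<bar>Q\<bar> * norm (s - r)"
    proof (rule field_differentiable_bound[of "{0..R}" F D])
      show "(F has_field_derivative D z) (at z within {0..R})" for z
        using D(1) by (rule has_field_derivative_at_within)
      show "norm (D z) \<le> \<bar>Q\<bar>" if "z \<in> {0..R}" for z using Q[OF that] by simp
    qed (use rs in auto)
    then show "F s - F r \<le> \<bar>Q\<bar> * (s - r)" using rs by auto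
  qed simp
qed

text \<open>Neither a nonlinearity nor a solution is fixed here, so that the two can later exchange
  roles.\<close>

locale boundary_measurement =
  fixes \<Omega> :: "(real^'n) set" and A :: "real^'n \<Rightarrow> real \<Rightarrow> real^'n^'n"
    and B :: "real^'n \<Rightarrow> real \<Rightarrow> real^'n" and \<nu> :: "real^'n \<Rightarrow> real^'n"
    and g :: "real^'n \<Rightarrow> real" and \<phi> :: "real \<Rightarrow> real" and S :: "(real^'n) set" and \<alpha> T c R :: real
  assumes T: "0 < T"
    and domain: "is_bounded_holder_domain 2 \<alpha> \<Omega>"
    and normal: "\<forall>x\<in>frontier \<Omega>. is_unit_outward_normal \<Omega> x (\<nu> x)"
    and B: "holder_on 1 \<alpha> (closure \<Omega> \<times> {0..T}) (\<lambda>(x, t). B x t)"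
    and A_reg: "\<forall>i j. holder_on 1 \<alpha> (closure \<Omega> \<times> {0..T}) (\<lambda>(x, t). A x t $ i $ j)"
    and A_sym: "\<forall>x\<in>closure \<Omega>. \<forall>t\<in>{0..T}. \<forall>i j. A x t $ i $ j = A x t $ j $ i"
    and A_ell: "c > 0" "\<forall>x\<in>closure \<Omega>. \<forall>t\<in>{0..T}. \<forall>\<xi>. \<xi> \<bullet> (A x t *v \<xi>) \<ge> c * (norm \<xi>)\<^sup>2"
    and R: "R > 0" and g_range: "g ` frontier \<Omega> = {0..R}"
    and \<phi>: "continuous_on {0..T} \<phi>" "mono_on {0..T} \<phi>" "\<phi> 0 = 0" "\<phi> T = 1"
    and S: "openin (top_of_set (frontier \<Omega>)) S" "S \<noteq> {}"
begin

text \<open>The first-order coefficient once the divergence has been expanded.\<close>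

definition drift :: "real^'n \<Rightarrow> real \<Rightarrow> real^'n" where
  "drift x t = B x t - (\<chi> j. \<Sum>i\<in>UNIV. space_partial \<Omega> i (\<lambda>y s. A y s $ i $ j) x t)"

lemma \<Omega>: "open \<Omega>" "connected \<Omega>" "\<Omega> \<noteq> {}" "bounded \<Omega>" "holder_boundary 2 \<alpha> \<Omega>"
  using domain by (auto simp: is_bounded_holder_domain_def)

lemma in_closure: "x \<in> \<Omega> \<Longrightarrow> x \<in> closure \<Omega>"
  using closure_subset by blast

lemma operator: obtains C where "parabolic_operator \<Omega> T c C A drift"
proof -
  obtain C where C: "0 < C" "\<And>x t. x \<in> \<Omega> \<Longrightarrow> t \<in> {0<..<T} \<Longrightarrow> norm (A x t) \<le> C"
    "\<And>x t. x \<in> \<Omega> \<Longrightarrow> t \<in> {0<..<T} \<Longrightarrow> norm (drift x t) \<le> C"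
    using coefficient_bounds[OF \<Omega>(1,4) B A_reg[rule_format]] unfolding drift_def by blast
  show thesis
  proof (rule that, unfold_locales)
    fix x t assume xt: "x \<in> \<Omega>" "t \<in> {0<..<T}"
    then have xt': "x \<in> closure \<Omega>" "t \<in> {0..T}" by (auto simp: in_closure)
    have ell: "c * (norm \<xi>)\<^sup>2 \<le> \<xi> \<bullet> (A x t *v \<xi>)" for \<xi> using A_ell(2) xt' by blast
    then show "c * (\<xi> \<bullet> \<xi>) \<le> \<xi> \<bullet> (A x t *v \<xi>)" for \<xi> by (simp add: dot_square_norm)
    have "0 \<le> \<xi> \<bullet> (A x t *v \<xi>)" for \<xi>
      using order_trans[OF _ ell] A_ell(1) by simp
    then show "psd (A x t)" using A_sym xt' by (auto simp: psd_def)
  qed (use C \<Omega> A_ell in auto)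
qed

lemma g_bounds: "x \<in> frontier \<Omega> \<Longrightarrow> 0 \<le> g x \<and> g x \<le> R"
  using g_range by auto

lemma \<phi>_nonneg: "t \<in> {0..T} \<Longrightarrow> 0 \<le> \<phi> t"
  using mono_onD[OF \<phi>(2), of 0 t] \<phi>(3) T by simp

section \<open>Bounds for a single solution\<close>

context
  fixes F u
  assumes u: "is_semilinear_solution \<alpha> \<Omega> T A B F \<phi> g u"
begin

lemma solution_holder: "parabolic_holder \<alpha> \<Omega> T u"
  using u by (simp add: is_semilinear_solution_def)

lemmas solution_continuous = parabolic_holder_continuous[OF solution_holder]

lemma solution_initial:
  assumes x: "x \<in> closure \<Omega>"
  shows "u x 0 = 0"
proof (rule continuous_constant_on_closure[of \<Omega> "\<lambda>x. u x 0"])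
  show "continuous_on (closure \<Omega>) (\<lambda>x. u x 0)"
    using parabolic_holder_imp(1)[OF solution_holder, of 0] T
    by (intro differentiable_imp_continuous_on) auto
qed (use u x in \<open>auto simp: is_semilinear_solution_def\<close>)

lemma solution_boundary:
  assumes "x \<in> frontier \<Omega>" "0 \<le> t" "t < T"
  shows "u x t = \<phi> t * g x"
proof (cases "t = 0")
  case True
  then show ?thesis using solution_initial[of x] assms(1) \<phi>(3) by (simp add: frontier_def)
next
  case False
  then show ?thesis using u assms by (auto simp: is_semilinear_solution_def)
qed

lemma solution_jet:
  assumes x: "x \<in> \<Omega>" and t: "t \<in> {0<..<T}"
  obtains \<tau> p H where "parabolic_jet u x t \<tau> p H" "\<tau> - A x t \<bullet> H + drift x t \<bullet> p = - F (u x t)"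
proof -
  let ?H = "\<chi> i j. space_partial \<Omega> j (space_partial \<Omega> i u) x t"
  have "time_deriv T u x t - space_div \<Omega> (\<lambda>y s. A y s *v space_grad \<Omega> u y s) x t
      + B x t \<bullet> space_grad \<Omega> u x t + F (u x t) = 0"
    using u x t by (auto simp: is_semilinear_solution_def)
  moreover have "A x t $ i $ j = A x t $ j $ i" for i j
    using A_sym in_closure[OF x] t by auto
  ultimately have "time_deriv T u x t - A x t \<bullet> ?H + drift x t \<bullet> space_grad \<Omega> u x t = - F (u x t)"
    using space_div_matrix_grad[where A = A, OF solution_holder \<Omega>(1) x t
        holder_on_one_slice(1)[where f = "\<lambda>y s. A y s $ i $ j" for i j, OF A_reg[rule_format] \<Omega>(1) x t]]
    by (simp add: drift_def inner_diff_left)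
  then show thesis using that parabolic_holder_jet[OF solution_holder \<Omega>(1) x t] by blast
qed

text \<open>Where \<open>u\<close> is negative, \<open>F u\<close> is nonpositive by monotonicity,
  so \<open>u\<close> is a supersolution exactly where the minimum principle asks for it; the upper
  bound is analogous.\<close>

lemma solution_range:
  assumes F: "mono F" "F 0 = 0" and x: "x \<in> closure \<Omega>" and t: "0 \<le> t" "t < T"
  shows "0 \<le> u x t" and "u x t \<le> R * \<phi> t"
proof -
  obtain C where "parabolic_operator \<Omega> T c C A drift" by (rule operator)
  then interpret parabolic_operator \<Omega> T c C A drift .
  have cont: "continuous_on (closure \<Omega> \<times> {0..t}) (\<lambda>z. u (fst z) (snd z))"
    using solution_continuous by (rule continuous_on_subset) (use t in auto)
  show "0 \<le> u x t"
  proof (rule minimum_principle_cylinder[OF t(2) cont])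
    fix y s assume ys: "y \<in> frontier \<Omega>" "s \<in> {0..t}"
    then show "0 \<le> u y s"
      using solution_boundary[of y s] g_bounds[OF ys(1)] \<phi>_nonneg[of s] t by simp
  next
    fix y s assume ys: "y \<in> \<Omega>" "s \<in> {0<..t}" "u y s < 0"
    have "F (u y s) \<le> 0" using monoD[OF F(1), of "u y s" 0] ys F(2) by simp
    then show "\<exists>\<tau> p H. parabolic_jet u y s \<tau> p H \<and> 0 \<le> \<tau> - A y s \<bullet> H + drift y s \<bullet> p"
      using solution_jet[of y s] ys t by (metis greaterThanAtMost_iff greaterThanLessThan_iff
          neg_0_le_iff_le order_le_less_trans)
  qed (use x t solution_initial in auto)
  \<comment> \<open>The level is frozen at the time \<open>t\<close> of the claim: it dominates all
    earlier boundary values since \<open>\<phi>\<close> is monotone, and a constant has zero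
    derivatives.\<close>
  have "0 \<le> R * \<phi> t - u x t"
  proof (rule minimum_principle_cylinder[OF t(2), where v = "\<lambda>x s. R * \<phi> t - u x s"])
    show "continuous_on (closure \<Omega> \<times> {0..t}) (\<lambda>z. R * \<phi> t - u (fst z) (snd z))"
      by (intro continuous_intros cont)
  next
    fix y assume "y \<in> closure \<Omega>"
    then show "0 \<le> R * \<phi> t - u y 0" using solution_initial R \<phi>_nonneg[of t] t by simp
  next
    fix y s assume ys: "y \<in> frontier \<Omega>" "s \<in> {0..t}"
    have "\<phi> s * g y \<le> \<phi> t * R"
      using g_bounds[OF ys(1)] \<phi>_nonneg t ys mono_onD[OF \<phi>(2), of s t] by (intro mult_mono) auto
    then show "0 \<le> R * \<phi> t - u y s"
      using solution_boundary[of y s] ys t by (simp add: mult.commute)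
  next
    fix y s assume ys: "y \<in> \<Omega>" "s \<in> {0<..t}" "R * \<phi> t - u y s < 0"
    have "0 \<le> R * \<phi> t" using R \<phi>_nonneg[of t] t by simp
    then have F0: "0 \<le> F (u y s)" using monoD[OF F(1), of 0 "u y s"] ys F(2) by simp
    have sT: "s \<in> {0<..<T}" using ys t by auto
    obtain \<tau> p H where J: "parabolic_jet u y s \<tau> p H"
        "\<tau> - A y s \<bullet> H + drift y s \<bullet> p = - F (u y s)"
      using solution_jet[OF ys(1) sT] by blast
    have "parabolic_jet (\<lambda>x s. R * \<phi> t - u x s) y s (0 - \<tau>) (0 - p) (0 - H)"
      by (intro parabolic_jet_diff parabolic_jet_const J)
    then show "\<exists>\<tau> p H. parabolic_jet (\<lambda>x s. R * \<phi> t - u x s) y s \<tau> p H \<and>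
        0 \<le> \<tau> - A y s \<bullet> H + drift y s \<bullet> p"
      using J(2) F0 by (intro exI[of _ "0 - \<tau>"] exI[of _ "0 - p"] exI[of _ "0 - H"]) simp
  qed (use x t in auto)
  then show "u x t \<le> R * \<phi> t" by simp
qed

end

lemma difference_jet:
  assumes u: "is_semilinear_solution \<alpha> \<Omega> T A B F\<^sub>1 \<phi> g u\<^sub>1" "is_semilinear_solution \<alpha> \<Omega> T A B F\<^sub>2 \<phi> g u\<^sub>2"
    and x: "x \<in> \<Omega>" "t \<in> {0<..<T}"
  obtains \<tau> p H where "parabolic_jet (\<lambda>x t. u\<^sub>1 x t - u\<^sub>2 x t) x t \<tau> p H"
    "\<tau> - A x t \<bullet> H + drift x t \<bullet> p = F\<^sub>2 (u\<^sub>2 x t) - F\<^sub>1 (u\<^sub>1 x t)"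
proof -
  obtain \<tau> p H where J: "parabolic_jet u\<^sub>1 x t \<tau> p H"
      "\<tau> - A x t \<bullet> H + drift x t \<bullet> p = - F\<^sub>1 (u\<^sub>1 x t)"
    using solution_jet[OF u(1) x] by blast
  obtain \<tau>' p' H' where J': "parabolic_jet u\<^sub>2 x t \<tau>' p' H'"
      "\<tau>' - A x t \<bullet> H' + drift x t \<bullet> p' = - F\<^sub>2 (u\<^sub>2 x t)"
    using solution_jet[OF u(2) x] by blast
  show thesis
    by (rule that[OF parabolic_jet_diff[OF J(1) J'(1)]])
       (use J(2) J'(2) in \<open>simp add: inner_diff_right\<close>)
qed

text \<open>
  If \<open>F\<^sub>1 \<le> F\<^sub>2\<close> on the range of the solutions, then \<open>u\<^sub>1 - u\<^sub>2\<close> is a nonnegative supersolution, and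
  by Hopf's lemma it could not have zero conormal derivative on \<open>S\<close> if it were positive somewhere.
\<close>

lemma solutions_equal:
  assumes u: "is_semilinear_solution \<alpha> \<Omega> T A B F\<^sub>1 \<phi> g u\<^sub>1" "is_semilinear_solution \<alpha> \<Omega> T A B F\<^sub>2 \<phi> g u\<^sub>2"
    and F1: "F\<^sub>1 C1_differentiable_on UNIV" "F\<^sub>1 0 = 0" "\<forall>s. deriv F\<^sub>1 s \<ge> 0"
    and F2: "F\<^sub>2 C1_differentiable_on UNIV" "F\<^sub>2 0 = 0" "\<forall>s. deriv F\<^sub>2 s \<ge> 0"
    and conormal: "\<And>x t. x \<in> S \<Longrightarrow> t \<in> {0<..<T} \<Longrightarrow>
      conormal_deriv \<Omega> \<nu> A u\<^sub>1 x t = conormal_deriv \<Omega> \<nu> A u\<^sub>2 x t"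
    and t0: "0 < t0" "t0 < T" and le: "\<And>r. r \<in> {0..R * \<phi> t0} \<Longrightarrow> F\<^sub>1 r \<le> F\<^sub>2 r"
    and x: "x \<in> \<Omega>" and t: "t \<in> {0<..<t0}"
  shows "u\<^sub>1 x t = u\<^sub>2 x t"
proof -
  obtain C where "parabolic_operator \<Omega> T c C A drift" by (rule operator)
  then interpret parabolic_operator \<Omega> T c C A drift .
  note m1 = C1_nondecreasing(1)[OF F1(1,3)] and m2 = C1_nondecreasing(1)[OF F2(1,3)]
  note r1 = solution_range[OF u(1) m1 F1(2)] and r2 = solution_range[OF u(2) m2 F2(2)]
  define w where "w = (\<lambda>x t. u\<^sub>1 x t - u\<^sub>2 x t)"
  have \<phi>R: "R * \<phi> t \<le> R * \<phi> t0" "R * \<phi> t0 \<le> R" if "t \<in> {0..t0}" for t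
    using that t0 R mono_onD[OF \<phi>(2), of t t0] mono_onD[OF \<phi>(2), of t0 T] \<phi>(4) by auto
  have cont: "continuous_on (closure \<Omega> \<times> {0..t0}) (\<lambda>z. w (fst z) (snd z))"
    unfolding w_def
    by (intro continuous_intros continuous_on_subset[OF solution_continuous[OF u(1)]]
        continuous_on_subset[OF solution_continuous[OF u(2)]]) (use t0 in auto)
  have le2: "F\<^sub>1 (u\<^sub>2 x t) \<le> F\<^sub>2 (u\<^sub>2 x t)" if "x \<in> \<Omega>" "t \<in> {0<..t0}" for x t
    using r2[of x t] \<phi>R[of t] that t0 in_closure by (intro le) auto
  have nonneg: "0 \<le> w x t" if "x \<in> closure \<Omega>" "t \<in> {0..t0}" for x t
  proof (rule minimum_principle_cylinder[OF t0(2) cont])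
    fix y assume "y \<in> closure \<Omega>"
    then show "0 \<le> w y 0" using solution_initial[OF u(1)] solution_initial[OF u(2)] by (simp add: w_def)
  next
    fix y s assume "y \<in> frontier \<Omega>" "s \<in> {0..t0}"
    then show "0 \<le> w y s"
      using solution_boundary[OF u(1), of y s] solution_boundary[OF u(2), of y s] t0 by (simp add: w_def)
  next
    fix y s assume ys: "y \<in> \<Omega>" "s \<in> {0<..t0}" "w y s < 0"
    \<comment> \<open>Where \<open>u\<^sub>1 < u\<^sub>2\<close>, monotonicity of
      \<open>F\<^sub>1\<close> and the ordering of the nonlinearities at \<open>u\<^sub>2\<close>
      work in the same direction.\<close>
    have "F\<^sub>1 (u\<^sub>1 y s) \<le> F\<^sub>1 (u\<^sub>2 y s)" using ys(3) by (intro monoD[OF m1]) (simp add: w_def)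
    then have "0 \<le> F\<^sub>2 (u\<^sub>2 y s) - F\<^sub>1 (u\<^sub>1 y s)" using le2[OF ys(1,2)] by simp
    moreover have sT: "s \<in> {0<..<T}" using ys(2) t0 by auto
    obtain \<tau> p H where "parabolic_jet w y s \<tau> p H"
        "\<tau> - A y s \<bullet> H + drift y s \<bullet> p = F\<^sub>2 (u\<^sub>2 y s) - F\<^sub>1 (u\<^sub>1 y s)"
      unfolding w_def by (rule difference_jet[OF u ys(1) sT])
    ultimately show "\<exists>\<tau> p H. parabolic_jet w y s \<tau> p H \<and> 0 \<le> \<tau> - A y s \<bullet> H + drift y s \<bullet> p"
      by (intro exI[of _ \<tau>] exI[of _ p] exI[of _ H]) simp
  qed (use that in auto)
  obtain Q where Q: "Q \<ge> 0" "\<And>r s. r \<in> {0..R} \<Longrightarrow> s \<in> {r..R} \<Longrightarrow> F\<^sub>1 s - F\<^sub>1 r \<le> Q * (s - r)"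
    using C1_nondecreasing(3)[OF F1(1,3), of R] by blast
  interpret parabolic_supersolution \<Omega> T c C A drift w Q t0
  proof
    fix y s assume ys: "y \<in> \<Omega>" "s \<in> {0<..t0}"
    \<comment> \<open>The one-sided Lipschitz bound needs \<open>u\<^sub>2\<close> below
      \<open>u\<^sub>1\<close>, which \<open>nonneg\<close> has just provided.\<close>
    have "u\<^sub>2 y s \<in> {0..R}" "u\<^sub>1 y s \<in> {u\<^sub>2 y s..R}"
      using nonneg[of y s] r1[of y s] r2[of y s] \<phi>R[of s] ys t0 in_closure by (auto simp: w_def)
    then have "F\<^sub>1 (u\<^sub>1 y s) - F\<^sub>1 (u\<^sub>2 y s) \<le> Q * w y s" unfolding w_def by (rule Q(2))
    then have "- Q * w y s \<le> F\<^sub>2 (u\<^sub>2 y s) - F\<^sub>1 (u\<^sub>1 y s)" using le2[OF ys] by simp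
    moreover have sT: "s \<in> {0<..<T}" using ys(2) t0 by auto
    obtain \<tau> p H where "parabolic_jet w y s \<tau> p H"
        "\<tau> - A y s \<bullet> H + drift y s \<bullet> p = F\<^sub>2 (u\<^sub>2 y s) - F\<^sub>1 (u\<^sub>1 y s)"
      unfolding w_def by (rule difference_jet[OF u ys(1) sT])
    ultimately show "\<exists>\<tau> p H. parabolic_jet w y s \<tau> p H \<and> - Q * w y s \<le> \<tau> - A y s \<bullet> H + drift y s \<bullet> p"
      by (intro exI[of _ \<tau>] exI[of _ p] exI[of _ H]) simp
  qed (rule t0(2) Q(1) cont nonneg | assumption)+
  have "w x t = 0"
  proof (rule ccontr)
    assume "w x t \<noteq> 0"
    then have pos: "0 < w x t" using nonneg[of x t] x t in_closure by fastforce
    obtain x0 y r where b: "x0 \<in> S" "0 < r" "ball y r \<subseteq> \<Omega>" "dist y x0 = r"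
      by (rule interior_sphere_point[OF \<Omega>(1) S])
    have x0: "x0 \<in> frontier \<Omega>" using b(1) S(1) openin_imp_subset by blast
    then have x0': "x0 \<in> closure \<Omega>" by (simp add: frontier_def)
    obtain \<epsilon> where \<epsilon>: "\<epsilon> > 0" "\<And>x. x \<in> cball y r \<Longrightarrow> \<epsilon> * (r\<^sup>2 - (norm (x - y))\<^sup>2) \<le> w x t0"
      using hopf_growth[OF b(3,2) x _ _ pos] t by (meson greaterThanLessThan_iff)
    define n where "n = \<nu> x0"
    define q where "q = A x0 t0 *v n"
    have nu: "is_unit_outward_normal \<Omega> x0 n" using normal x0 by (simp add: n_def)
    then have n1: "norm n = 1" by (simp add: is_unit_outward_normal_def)
    have t0': "t0 \<in> {0..T}" using t0 by auto
    define G where "G = space_grad \<Omega> u\<^sub>1 x0 t0 - space_grad \<Omega> u\<^sub>2 x0 t0"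
    have der: "((\<lambda>y. u y t0) has_derivative (\<lambda>h. space_grad \<Omega> u x0 t0 \<bullet> h)) (at x0 within closure \<Omega>)"
      if "parabolic_holder \<alpha> \<Omega> T u" for u
      using parabolic_holder_imp(1)[OF that t0'] x0'
      by (intro has_derivative_space_grad) (auto simp: differentiable_on_def)
    have "((\<lambda>y. w y t0) has_derivative (\<lambda>h. G \<bullet> h)) (at x0 within closure \<Omega>)"
      using has_derivative_diff[OF der[OF solution_holder[OF u(1)]] der[OF solution_holder[OF u(2)]]]
      by (simp add: w_def G_def inner_diff_left)
    moreover have "cball y r \<subseteq> closure \<Omega>"
      using closure_mono[OF b(3)] b(2) by simp
    moreover note b(2) outward_normal_interior_sphere[OF \<Omega>(1,5) x0 nu b(2,3,4)] n1
    moreover have "c * (norm n)\<^sup>2 \<le> n \<bullet> q" using A_ell(2) x0' t0' by (simp add: q_def)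
    then have "0 < n \<bullet> q" using A_ell(1) n1 by simp
    moreover have "w x0 t0 = 0"
      using solution_boundary[OF u(1) x0, of t0] solution_boundary[OF u(2) x0, of t0] t0
      by (simp add: w_def)
    ultimately have "G \<bullet> q < 0" using \<epsilon> by (rule boundary_slope_negative)
    moreover have "(A x0 t0 *v h) \<bullet> n = h \<bullet> q" for h
    proof -
      have "transpose (A x0 t0) = A x0 t0"
        using A_sym x0' t0' by (simp add: transpose_def vec_eq_iff)
      then show ?thesis unfolding q_def by (metis dot_lmul_matrix vector_transpose_matrix inner_commute)
    qed
    then have "G \<bullet> q = 0"
      using conormal[OF b(1), of t0] t0
      by (simp add: conormal_deriv_def G_def inner_diff_left n_def)
    ultimately show False by simp
  qed
  then show ?thesis by (simp add: w_def)
qed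

text \<open>For \<open>0 < r < \<sigma>\<close> take the time \<open>t0\<close> at which the largest
  boundary value is \<open>r\<close>. The solutions agree before \<open>t0\<close>, so subtracting
  the equations equates the nonlinearities at the values of \<open>u\<^sub>2\<close>. The value
  \<open>r\<close> is reached in the limit, at time \<open>t0\<close> and at the boundary point
  where \<open>g\<close> equals \<open>R\<close>.\<close>

lemma nonlinearities_equal:
  assumes u: "is_semilinear_solution \<alpha> \<Omega> T A B F\<^sub>1 \<phi> g u\<^sub>1" "is_semilinear_solution \<alpha> \<Omega> T A B F\<^sub>2 \<phi> g u\<^sub>2"
    and F1: "F\<^sub>1 C1_differentiable_on UNIV" "F\<^sub>1 0 = 0" "\<forall>s. deriv F\<^sub>1 s \<ge> 0"
    and F2: "F\<^sub>2 C1_differentiable_on UNIV" "F\<^sub>2 0 = 0" "\<forall>s. deriv F\<^sub>2 s \<ge> 0"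
    and conormal: "\<And>x t. x \<in> S \<Longrightarrow> t \<in> {0<..<T} \<Longrightarrow>
      conormal_deriv \<Omega> \<nu> A u\<^sub>1 x t = conormal_deriv \<Omega> \<nu> A u\<^sub>2 x t"
    and \<sigma>: "\<sigma> \<le> R" and le: "\<And>r. r \<in> {0..\<sigma>} \<Longrightarrow> F\<^sub>1 r \<le> F\<^sub>2 r"
    and r: "r \<in> {0..\<sigma>}"
  shows "F\<^sub>1 r = F\<^sub>2 r"
proof -
  note c1 = C1_nondecreasing(2)[OF F1(1,3)] and c2 = C1_nondecreasing(2)[OF F2(1,3)]
  have interior: "F\<^sub>1 r = F\<^sub>2 r" if r: "r \<in> {0<..<\<sigma>}" for r
  proof -
    have "\<exists>t\<ge>0. t \<le> T \<and> \<phi> t = r / R"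
      using \<phi> r \<sigma> R T by (intro IVT') auto
    then obtain t0 where t0: "0 \<le> t0" "t0 \<le> T" "\<phi> t0 = r / R" by blast
    \<comment> \<open>This uses \<open>0 < r < R\<close>; the end points of
      \<open>{0..\<sigma>}\<close> are left to continuity.\<close>
    have "t0 \<noteq> 0" "t0 \<noteq> T" using t0(3) \<phi>(3,4) r \<sigma> R by auto
    then have t0': "0 < t0" "t0 < T" using t0 by auto
    have R\<phi>: "R * \<phi> t0 = r" using t0(3) R by simp
    have eq: "u\<^sub>1 x t = u\<^sub>2 x t" if "x \<in> \<Omega>" "t \<in> {0<..<t0}" for x t
      by (rule solutions_equal[OF u F1 F2 conormal t0' le that]) (use r R\<phi> in auto)
    obtain C where "parabolic_operator \<Omega> T c C A drift" by (rule operator)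
    then interpret parabolic_operator \<Omega> T c C A drift .
    have F: "F\<^sub>2 (u\<^sub>2 x t) - F\<^sub>1 (u\<^sub>2 x t) = 0" if xt: "x \<in> \<Omega>" "t \<in> {0<..<t0}" for x t
    proof -
      have tT: "t \<in> {0<..<T}" using xt t0' by auto
      obtain \<tau> p H where "parabolic_jet (\<lambda>x t. u\<^sub>1 x t - u\<^sub>2 x t) x t \<tau> p H"
          "\<tau> - A x t \<bullet> H + drift x t \<bullet> p = F\<^sub>2 (u\<^sub>2 x t) - F\<^sub>1 (u\<^sub>1 x t)"
        using difference_jet[OF u xt(1) tT] by blast
      then show ?thesis
        using parabolic_jet_zero[OF _ psd_a[OF xt(1) tT] \<Omega>(1) xt, of "\<lambda>x t. u\<^sub>1 x t - u\<^sub>2 x t"] eq xt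
        by simp
    qed
    obtain x where x: "x \<in> frontier \<Omega>" "g x = R" using g_range R
      by (metis atLeastAtMost_iff imageE less_imp_le order_refl)
    have cl: "closure (\<Omega> \<times> {0<..<t0}) = closure \<Omega> \<times> {0..t0}"
      using t0' by (simp add: closure_Times)
    have cu: "continuous_on (closure (\<Omega> \<times> {0<..<t0})) (\<lambda>z. u\<^sub>2 (fst z) (snd z))"
      unfolding cl using solution_continuous[OF u(2)]
      by (rule continuous_on_subset) (use t0' in auto)
    have "F\<^sub>2 (u\<^sub>2 (fst (x, t0)) (snd (x, t0))) - F\<^sub>1 (u\<^sub>2 (fst (x, t0)) (snd (x, t0))) = 0"
    proof (rule continuous_constant_on_closure[of "\<Omega> \<times> {0<..<t0}"
          "\<lambda>z. F\<^sub>2 (u\<^sub>2 (fst z) (snd z)) - F\<^sub>1 (u\<^sub>2 (fst z) (snd z))"])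
      show "continuous_on (closure (\<Omega> \<times> {0<..<t0}))
          (\<lambda>z. F\<^sub>2 (u\<^sub>2 (fst z) (snd z)) - F\<^sub>1 (u\<^sub>2 (fst z) (snd z)))"
        by (intro continuous_on_diff continuous_on_compose2[OF c1 cu] continuous_on_compose2[OF c2 cu]) auto
      show "(x, t0) \<in> closure (\<Omega> \<times> {0<..<t0})"
        unfolding cl using x(1) t0' by (simp add: frontier_def)
    qed (use F in auto)
    moreover have "u\<^sub>2 x t0 = r"
      using solution_boundary[OF u(2) x(1), of t0] t0' R\<phi> x(2) by (simp add: mult.commute)
    ultimately show ?thesis by simp
  qed
  show ?thesis
  proof (cases "0 < \<sigma>")
    case True
    have "F\<^sub>1 r - F\<^sub>2 r = 0"
    proof (rule continuous_constant_on_closure[of "{0<..<\<sigma>}" "\<lambda>r. F\<^sub>1 r - F\<^sub>2 r"])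
      show "continuous_on (closure {0<..<\<sigma>}) (\<lambda>r. F\<^sub>1 r - F\<^sub>2 r)"
        using c1 c2 by (intro continuous_on_diff) (auto intro: continuous_on_subset)
    qed (use True r interior in auto)
    then show ?thesis by simp
  next
    case False
    then have "r = 0" using r by simp
    then show ?thesis using F1(2) F2(2) by simp
  qed
qed

end

section \<open>The ramp and the induction over the sign intervals\<close>

lemma C_infinity_on_imp:
  assumes "C_infinity_on S f"
  shows "continuous_on S f" "f differentiable_on S"
proof -
  have "C_diff_on 0 S f" "C_diff_on (Suc 0) S f" using assms unfolding C_infinity_on_def by blast+
  then show "continuous_on S f" "f differentiable_on S" by auto
qed

text \<open>On \<open>{0..T}\<close> the ramp is \<open>f\<close> after truncation to
  \<open>{T\<^sub>1..T\<^sub>2}\<close>, and both maps are monotone. The prescriptions overlap at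
  \<open>T\<^sub>1\<close> and \<open>T\<^sub>2\<close>, which yields the end values 0 and 1 of
  \<open>f\<close>.\<close>

lemma ramp_mono:
  fixes \<phi> f :: "real \<Rightarrow> real"
  assumes times: "0 \<le> T\<^sub>1" "T\<^sub>1 < T\<^sub>2" "T\<^sub>2 \<le> T"
    and \<phi>: "\<forall>t\<in>{0..T\<^sub>1}. \<phi> t = 0" "\<forall>t\<in>{T\<^sub>1..T\<^sub>2}. \<phi> t = f t" "\<forall>t\<in>{T\<^sub>2..T}. \<phi> t = 1"
    and f: "C_infinity_on {T\<^sub>1..T\<^sub>2} f" "\<forall>t\<in>{T\<^sub>1<..<T\<^sub>2}. deriv f t > 0"
  shows "mono_on {0..T} \<phi>"
proof (rule mono_onI)
  have f_mono: "f s \<le> f t" if "T\<^sub>1 \<le> s" "s \<le> t" "t \<le> T\<^sub>2" for s t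
  proof (rule DERIV_nonneg_imp_increasing_open[OF that(2)])
    fix x assume x: "s < x" "x < t"
    have "f differentiable (at x within {T\<^sub>1..T\<^sub>2})"
      using C_infinity_on_imp(2)[OF f(1)] x that by (auto simp: differentiable_on_def)
    moreover have "at x within {T\<^sub>1..T\<^sub>2} = at x" using x that by (intro at_within_interior) auto
    ultimately have "(f has_real_derivative deriv f x) (at x)"
      by (simp add: DERIV_deriv_iff_real_differentiable)
    moreover have "0 \<le> deriv f x" using f(2) x that by (intro less_imp_le) auto
    ultimately show "\<exists>y. (f has_real_derivative y) (at x) \<and> 0 \<le> y" by blast
  next
    show "continuous_on {s..t} f"
      using C_infinity_on_imp(1)[OF f(1)] by (rule continuous_on_subset) (use that in auto)
  qed
  have f1: "f T\<^sub>1 = 0" using \<phi>(1,2) times by (metis atLeastAtMost_iff less_imp_le order_refl)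
  have f2: "f T\<^sub>2 = 1" using \<phi>(2,3) times by (metis atLeastAtMost_iff less_imp_le order_refl)
  fix s t assume st: "s \<in> {0..T}" "t \<in> {0..T}" "s \<le> t"
  define h where "h = (\<lambda>t. f (max T\<^sub>1 (min T\<^sub>2 t)))"
  have "\<phi> t = h t" if t: "t \<in> {0..T}" for t
  proof -
    consider "t \<le> T\<^sub>1" | "t \<in> {T\<^sub>1..T\<^sub>2}" | "T\<^sub>2 \<le> t" by fastforce
    then show ?thesis
      by cases (use t \<phi> f1 f2 times in \<open>auto simp: h_def min_def max_def\<close>)
  qed
  moreover have "h s \<le> h t" unfolding h_def using st(3) times by (intro f_mono) auto
  ultimately show "\<phi> s \<le> \<phi> t" using st by simp
qed

theorem theorem2p1:
  fixes \<Omega> :: "(real^'n) set"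
    and A :: "real^'n \<Rightarrow> real \<Rightarrow> real^'n^'n"
    and B :: "real^'n \<Rightarrow> real \<Rightarrow> real^'n"
    and \<nu> :: "real^'n \<Rightarrow> real^'n"
    and g :: "real^'n \<Rightarrow> real"
    and \<phi> f F\<^sub>1 F\<^sub>2 :: "real \<Rightarrow> real"
    and u\<^sub>1 u\<^sub>2 :: "real^'n \<Rightarrow> real \<Rightarrow> real"
    and S :: "(real^'n) set"
    and \<alpha> T T\<^sub>1 T\<^sub>2 c \<kappa> R :: real
  assumes alpha: "0 < \<alpha>" "\<alpha> < 1"
    and T: "0 < T"
    and domain: "is_bounded_holder_domain 2 \<alpha> \<Omega>"
    and normal: "\<forall>x\<in>frontier \<Omega>. is_unit_outward_normal \<Omega> x (\<nu> x)"
    and B: "holder_on 1 \<alpha> (closure \<Omega> \<times> {0..T}) (\<lambda>(x, t). B x t)"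
    and A_reg: "\<forall>i j. holder_on 1 \<alpha> (closure \<Omega> \<times> {0..T}) (\<lambda>(x, t). A x t $ i $ j)"
    and A_sym: "\<forall>x\<in>closure \<Omega>. \<forall>t\<in>{0..T}. \<forall>i j. A x t $ i $ j = A x t $ j $ i"
    and A_ell: "c > 0" "\<forall>x\<in>closure \<Omega>. \<forall>t\<in>{0..T}. \<forall>\<xi>. \<xi> \<bullet> (A x t *v \<xi>) \<ge> c * (norm \<xi>)\<^sup>2"
    and constants: "\<kappa> > 0" "R > 0"
    and g: "boundary_holder 2 \<alpha> \<Omega> g" "boundary_holder_norm 2 \<alpha> \<Omega> g \<le> ennreal \<kappa>"
    and g_range: "g ` frontier \<Omega> = {0..R}"
    and phi: "C_infinity_on {0..T} \<phi>" "holder_norm 1 (\<alpha> / 2) {0..T} \<phi> \<le> ennreal \<kappa>"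
    and times: "0 \<le> T\<^sub>1" "T\<^sub>1 < T\<^sub>2" "T\<^sub>2 \<le> T" "T\<^sub>2 - T\<^sub>1 \<ge> T / 4"
    and phi_shape: "\<forall>t\<in>{0..T\<^sub>1}. \<phi> t = 0" "\<forall>t\<in>{T\<^sub>1..T\<^sub>2}. \<phi> t = f t" "\<forall>t\<in>{T\<^sub>2..T}. \<phi> t = 1"
    and f: "C_infinity_on {T\<^sub>1..T\<^sub>2} f" "\<forall>t\<in>{T\<^sub>1<..<T\<^sub>2}. deriv f t > 0"
    and F1: "F\<^sub>1 C1_differentiable_on UNIV" "F\<^sub>1 0 = 0" "\<forall>s. deriv F\<^sub>1 s \<ge> 0"
    and F2: "F\<^sub>2 C1_differentiable_on UNIV" "F\<^sub>2 0 = 0" "\<forall>s. deriv F\<^sub>2 s \<ge> 0"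
    and u1: "is_semilinear_solution \<alpha> \<Omega> T A B F\<^sub>1 \<phi> g u\<^sub>1"
    and u2: "is_semilinear_solution \<alpha> \<Omega> T A B F\<^sub>2 \<phi> g u\<^sub>2"
    and S: "openin (top_of_set (frontier \<Omega>)) S" "S \<noteq> {}"
    and conormal_eq: "\<forall>x\<in>S. \<forall>t\<in>{0<..<T}.
          conormal_deriv \<Omega> \<nu> A u\<^sub>1 x t = conormal_deriv \<Omega> \<nu> A u\<^sub>2 x t"
  shows "changes_sign_infinitely (\<lambda>s. F\<^sub>2 s - F\<^sub>1 s) R \<or> (\<forall>s\<in>{0..R}. F\<^sub>1 s = F\<^sub>2 s)"
proof (cases "changes_sign_infinitely (\<lambda>s. F\<^sub>2 s - F\<^sub>1 s) R")
  case False
  then obtain N s where s: "s 0 = 0" "s (Suc N) = R" "\<And>j. j \<le> N \<Longrightarrow> s j \<le> s (Suc j)"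
    and sign: "\<And>j. j \<le> N \<Longrightarrow> (\<forall>r\<in>{s j..s (Suc j)}. F\<^sub>1 r \<le> F\<^sub>2 r) \<or> (\<forall>r\<in>{s j..s (Suc j)}. F\<^sub>2 r \<le> F\<^sub>1 r)"
    by (auto simp: changes_sign_infinitely_def changes_sign_at_most_def)
  interpret boundary_measurement \<Omega> A B \<nu> g \<phi> S \<alpha> T c R
  proof
    show "mono_on {0..T} \<phi>" using ramp_mono times phi_shape f by blast
    show "continuous_on {0..T} \<phi>" using C_infinity_on_imp(1) phi(1) by blast
    show "\<phi> 0 = 0" "\<phi> T = 1" using phi_shape times by auto
  qed (rule T domain normal B A_reg A_sym A_ell constants g_range S)+
  \<comment> \<open>Induction downwards from \<open>s (Suc N) = R\<close>.\<close>
  have sR: "s j \<le> R" if "j \<le> Suc N" for j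
    using that
  proof (induction rule: inc_induct)
    case (step n)
    then show ?case using s(3)[of n] by simp
  qed (simp add: s)
  have "\<forall>r\<in>{0..s j}. F\<^sub>1 r = F\<^sub>2 r" if "j \<le> Suc N" for j
    using that
  proof (induction j)
    case 0
    then show ?case using s(1) F1(2) F2(2) by simp
  next
    case (Suc j)
    then have IH: "\<forall>r\<in>{0..s j}. F\<^sub>1 r = F\<^sub>2 r" and j: "j \<le> N" by auto
    show ?case using sign[OF j]
    proof
      assume *: "\<forall>r\<in>{s j..s (Suc j)}. F\<^sub>1 r \<le> F\<^sub>2 r"
      \<comment> \<open>Equality up to \<open>s j\<close> extends the sign on the new interval down
        to 0.\<close>
      have "F\<^sub>1 r \<le> F\<^sub>2 r" if "r \<in> {0..s (Suc j)}" for r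
        using IH * that by (cases "r \<le> s j") auto
      then show ?thesis
        using nonlinearities_equal[OF u1 u2 F1 F2 _ sR[OF Suc.prems]] conormal_eq by blast
    next
      \<comment> \<open>For the opposite sign the two problems exchange roles.\<close>
      assume *: "\<forall>r\<in>{s j..s (Suc j)}. F\<^sub>2 r \<le> F\<^sub>1 r"
      have "F\<^sub>2 r \<le> F\<^sub>1 r" if "r \<in> {0..s (Suc j)}" for r
        using IH * that by (cases "r \<le> s j") auto
      then show ?thesis
        using nonlinearities_equal[OF u2 u1 F2 F1 _ sR[OF Suc.prems]] conormal_eq by metis
    qed
  qed
  from this[of "Suc N"] show ?thesis by (simp add: s(2))
qed simp

end
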